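(* Let $m$ be even, let $\Gamma=\Gamma_{A_{nm-1}}$ and let $((\Gamma)^m,\tau^m)$ be its $m$-th power. Then $((\Gamma)^m,\tau^m)$ decomposes into $m$ or $m+1$ connected components. In fact $$ (\Gamma)^m=\Gamma^m_{A_{n-1}}\cup\bigcup_{i=1}^{\frac m2-1}\Big(\Gamma_{(1,i+2)}\cup\Gamma_{(2,i+3)}\Big)\cup\Gamma_{(1,\frac m2+2)}\qquad\text{if }\tfrac m2\text{ is even}, $$ $$ (\Gamma)^m=\Gamma^m_{A_{n-1}}\cup\bigcup_{i=1}^{\frac m2-1}\Big(\Gamma_{(1,i+2)}\cup\Gamma_{(2,i+3)}\Big)\cup\bigcup_{k=1}^{2}\Gamma_{(k,\frac m2+1+k)}\qquad\text{if }\tfrac m2\text{ is odd}. $$ Furthermore, all the connected components aside from $\Gamma^m_{A_{n-1}}$ are isomorphic to $\mathbb{Z}A_n/\tau^{-\frac{n(m-2)}{2}}\Sigma^2$ and cylindrically shaped, except $\Gamma_{(1,\frac m2+2)}$ and $\Gamma_{(2,\frac m2+3)}$, which are isomorphic to $\mathbb{Z}A_n/\tau^{-\frac{n(m-2)}{4}}\Sigma$ and have the shape of a Möbius band.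
   Context: Let $n,m\in\mathbb{N}$, $N=nm+2$, and let $\Pi$ be a regular $N$-gon with vertices numbered clockwise, labels read modulo $N$; a diagonal is a straight line between two non-adjacent vertices. $\Gamma_{A_{nm-1}}$ is the stable translation quiver whose vertices are the diagonals of $\Pi$, with arrows $(i,j)\to(i,j+1)$ and $(i,j)\to(i+1,j)$ whenever the target is a diagonal, and translation $\tau(i,j)=(i-1,j-1)$. The $m$-th power $(\Gamma)^m$ of a translation quiver $(\Gamma,\tau)$ has the same vertices as $\Gamma$ and its arrows are the sectional paths of length $m$ in $\Gamma$, i.e. paths $x_0\to x_1\to\dots\to x_m$ with $\tau x_{i+1}\ne x_{i-1}$ for $1\le i\le m-1$ (whenever $\tau x_{i+1}$ is defined); it is a translation quiver with translation $\tau^m=\tau\circ\dots\circ\tau$ ($m$ times). Connected components are those of the translation quiver (vertices linked by arrows or by the translation $\tau^m$). $\Gamma_{(i,j)}$ denotes the connected component of $((\Gamma)^m,\tau^m)$ containing the diagonal $(i,j)$. An $m$-diagonal of $\Pi$ is a diagonal dividing $\Pi$ into an $(mr+2)$-gon and an $(m(n-r)+2)$-gon, $r=1,\dots,\lceil\frac{n-1}{2}\rceil$. $\Gamma^m_{A_{n-1}}$ is the translation quiver with vertices the $m$-diagonals, arrows $(i,j)\to(i,j+m)$ and $(i,j)\to(i+m,j)$ whenever the target is an $m$-diagonal, and translation $\tau_m(i,j)=(i-m,j-m)$; it is a connected component of $((\Gamma)^m,\tau^m)$. $\mathbb{Z}A_n$ is the stable translation quiver of the Dynkin quiver $A_n$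 (the Auslander-Reiten quiver of $\mathcal{D}^b(\mathrm{mod}\,KA_n)$, $K$ an algebraically closed field), on which the Auslander-Reiten translation $\tau$ and the shift $\Sigma$ act as automorphisms. Drawn as a horizontal strip with neighbouring vertices of a row at distance one, $\tau^{-1}$ moves every vertex one unit to the right, and $\Sigma$ moves every vertex $\frac{n+1}{2}$ units to the right and then reflects in the horizontal centre line. $\mathbb{Z}A_n/\varphi$ denotes the quotient of $\mathbb{Z}A_n$ by the group generated by the automorphism $\varphi$.
   Formalization: The Möbius-band exceptions are claimed only for m/2 odd; for m/2 even that component is proved a cylinder (for n=2, m=4 it has 10 vertices, the Möbius quotient 5). The count "m or m+1" is claimed for n≥2 only, as for n=1 there are no m-diagonals and m/2 even gives m-1. *)

theory Defs
  imports "HOL-Analysis.Analysis" "Graph_Theory.Digraph"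
begin

section \<open>Stable translation quivers\<close>

text \<open>
  Multiple arrows are allowed. Only stable translation quivers occur here, so the translation is a
  function defined on all vertices (its values outside the vertex set are irrelevant).
\<close>

record ('v, 'a) tquiver = "('v, 'a) pre_digraph" +
  transl :: "'v \<Rightarrow> 'v"

definition tq_iso ::
  "('v \<Rightarrow> 'w) \<Rightarrow> ('a \<Rightarrow> 'b) \<Rightarrow> ('v, 'a) tquiver \<Rightarrow> ('w, 'b) tquiver \<Rightarrow> bool" where
  "tq_iso f g Q R \<longleftrightarrow>
     bij_betw f (verts Q) (verts R) \<and>
     bij_betw g (arcs Q) (arcs R) \<and>
     (\<forall>a \<in> arcs Q. tail R (g a) = f (tail Q a) \<and> head R (g a) = f (head Q a)) \<and>
     (\<forall>x \<in> verts Q. f (transl Q x) = transl R (f x))"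

definition tq_isomorphic :: "('v, 'a) tquiver \<Rightarrow> ('w, 'b) tquiver \<Rightarrow> bool" where
  "tq_isomorphic Q R \<longleftrightarrow> (\<exists>f g. tq_iso f g Q R)"

text \<open>Equality up to the names of the arrows: same vertices, same translation, and the same number
  of arrows between any two vertices.\<close>

definition tq_same :: "('v, 'a) tquiver \<Rightarrow> ('v, 'b) tquiver \<Rightarrow> bool" where
  "tq_same Q R \<longleftrightarrow> (\<exists>g. tq_iso (\<lambda>x. x) g Q R)"

definition tq_full_sub :: "('v, 'a) tquiver \<Rightarrow> 'v set \<Rightarrow> ('v, 'a) tquiver" where
  "tq_full_sub Q V =
     Q\<lparr>verts := verts Q \<inter> V,
       arcs := {a \<in> arcs Q. tail Q a \<in> verts Q \<inter> V \<and> head Q a \<in> verts Q \<inter> V}\<rparr>"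

definition tq_is_union :: "('v, 'a) tquiver \<Rightarrow> ('v, 'a) tquiver set \<Rightarrow> bool" where
  "tq_is_union Q S \<longleftrightarrow>
     verts Q = (\<Union>C\<in>S. verts C) \<and>
     arcs Q = (\<Union>C\<in>S. arcs C) \<and>
     (\<forall>C\<in>S. (\<forall>a \<in> arcs C. tail C a = tail Q a \<and> head C a = head Q a) \<and>
             (\<forall>x \<in> verts C. transl C x = transl Q x))"

subsection \<open>Connected components\<close>

definition tq_link :: "('v, 'a) tquiver \<Rightarrow> ('v \<times> 'v) set" where
  "tq_link Q = {(tail Q a, head Q a) | a. a \<in> arcs Q} \<union> {(x, transl Q x) | x. x \<in> verts Q}"

definition tq_component :: "('v, 'a) tquiver \<Rightarrow> 'v \<Rightarrow> ('v, 'a) tquiver" where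
  "tq_component Q x = tq_full_sub Q {y. (x, y) \<in> (tq_link Q \<union> (tq_link Q)\<inverse>)\<^sup>*}"

definition tq_components :: "('v, 'a) tquiver \<Rightarrow> ('v, 'a) tquiver set" where
  "tq_components Q = tq_component Q ` verts Q"

subsection \<open>Powers\<close>

text \<open>
  A path \<open>x\<^sub>0 \<rightarrow> x\<^sub>1 \<rightarrow> \<dots> \<rightarrow> x\<^sub>m\<close> (with \<open>m \<ge> 1\<close>) is given by its list of arrows; the arrow \<open>p ! i\<close>
  goes from \<open>x\<^sub>i\<close> to \<open>x\<^sub>i\<^sub>+\<^sub>1\<close>.
\<close>

definition tq_path :: "('v, 'a) tquiver \<Rightarrow> 'a list \<Rightarrow> bool" where
  "tq_path Q p \<longleftrightarrow> p \<noteq> [] \<and> set p \<subseteq> arcs Q \<and>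
     (\<forall>i. Suc i < length p \<longrightarrow> head Q (p ! i) = tail Q (p ! Suc i))"

definition tq_sectional :: "('v, 'a) tquiver \<Rightarrow> 'a list \<Rightarrow> bool" where
  "tq_sectional Q p \<longleftrightarrow>
     (\<forall>i. Suc i < length p \<longrightarrow> transl Q (head Q (p ! Suc i)) \<noteq> tail Q (p ! i))"

definition tq_power :: "nat \<Rightarrow> ('v, 'a) tquiver \<Rightarrow> ('v, 'a list) tquiver" where
  "tq_power m Q =
     \<lparr>verts = verts Q,
      arcs = {p. tq_path Q p \<and> tq_sectional Q p \<and> length p = m},
      tail = (\<lambda>p. tail Q (hd p)),
      head = (\<lambda>p. head Q (last p)),
      transl = transl Q ^^ m\<rparr>"

subsection \<open>Orbits and quotients by the cyclic group generated by an automorphism\<close>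

text \<open>For \<open>f\<close> bijective on \<open>V\<close>, two points are related iff some integral power of \<open>f\<close> maps one to
  the other.\<close>

definition orbit_rel :: "'x set \<Rightarrow> ('x \<Rightarrow> 'x) \<Rightarrow> ('x \<times> 'x) set" where
  "orbit_rel V f = {(x, y) \<in> V \<times> V. \<exists>k. (f ^^ k) x = y \<or> (f ^^ k) y = x}"

text \<open>Here \<open>f\<close> and \<open>g\<close> are the actions on vertices and on arrows. The image under the tail map of an
  orbit of arrows is the orbit of their tails, and likewise for heads and the translation.\<close>

definition tq_quotient ::
  "('v, 'a) tquiver \<Rightarrow> ('v \<Rightarrow> 'v) \<Rightarrow> ('a \<Rightarrow> 'a) \<Rightarrow> ('v set, 'a set) tquiver" where
  "tq_quotient Q f g =
     \<lparr>verts = verts Q // orbit_rel (verts Q) f,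
      arcs = arcs Q // orbit_rel (arcs Q) g,
      tail = (\<lambda>A. tail Q ` A),
      head = (\<lambda>A. head Q ` A),
      transl = (\<lambda>X. transl Q ` X)\<rparr>"

section \<open>Diagonals of a regular polygon\<close>

text \<open>
  The vertices of the \<open>N\<close>-gon are the residues \<open>0, \<dots>, N - 1\<close> (so the label \<open>N\<close> is read as \<open>0\<close>);
  the diagonal \<open>(i, j) = (j, i)\<close> is the set of its two end points.
\<close>

definition dgl :: "nat \<Rightarrow> int \<Rightarrow> int \<Rightarrow> int set" where
  "dgl N i j = {i mod int N, j mod int N}"

definition diagonals :: "nat \<Rightarrow> int set set" where
  "diagonals N = {dgl N i j | i j. (j - i) mod int N \<noteq> 0 \<and>
     (j - i) mod int N \<noteq> 1 mod int N \<and> (i - j) mod int N \<noteq> 1 mod int N}"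

definition rotate_dgl :: "nat \<Rightarrow> int \<Rightarrow> int set \<Rightarrow> int set" where
  "rotate_dgl N c x = (\<lambda>i. (i + c) mod int N) ` x"

text \<open>\<open>\<Gamma>\<^sub>A\<close> of type \<open>A\<^sub>N\<^sub>-\<^sub>3\<close>.\<close>

definition Gamma_A :: "nat \<Rightarrow> (int set, int set \<times> int set) tquiver" where
  "Gamma_A N =
     \<lparr>verts = diagonals N,
      arcs = {(x, y). x \<in> diagonals N \<and> y \<in> diagonals N \<and>
               (\<exists>i j. x = dgl N i j \<and> (y = dgl N i (j + 1) \<or> y = dgl N (i + 1) j))},
      tail = fst, head = snd,
      transl = rotate_dgl N (- 1)\<rparr>"

text \<open>Number of vertices of the polygon cut off by \<open>(i, j)\<close> on the side \<open>i, i + 1, \<dots>, j\<close>.\<close>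

definition gon_size :: "nat \<Rightarrow> int \<Rightarrow> int \<Rightarrow> int" where
  "gon_size N i j = (j - i) mod int N + 1"

definition m_diagonals :: "nat \<Rightarrow> nat \<Rightarrow> int set set" where
  "m_diagonals n m = {x \<in> diagonals (n * m + 2). \<exists>i j r. x = dgl (n * m + 2) i j \<and>
     1 \<le> r \<and> r \<le> \<lceil>(real n - 1) / 2\<rceil> \<and>
     gon_size (n * m + 2) i j = int m * r + 2 \<and>
     gon_size (n * m + 2) j i = int m * (int n - r) + 2}"

text \<open>\<open>\<Gamma>\<^sup>m\<close> of type \<open>A\<^sub>n\<^sub>-\<^sub>1\<close> (the empty quiver if \<open>n = 1\<close>).\<close>

definition Gamma_mA :: "nat \<Rightarrow> nat \<Rightarrow> (int set, int set \<times> int set) tquiver" where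
  "Gamma_mA n m =
     \<lparr>verts = m_diagonals n m,
      arcs = {(x, y). x \<in> m_diagonals n m \<and> y \<in> m_diagonals n m \<and>
               (\<exists>i j. x = dgl (n * m + 2) i j \<and>
                  (y = dgl (n * m + 2) i (j + int m) \<or> y = dgl (n * m + 2) (i + int m) j))},
      tail = fst, head = snd,
      transl = rotate_dgl (n * m + 2) (- int m)\<rparr>"

definition Gamma_pow ::
  "nat \<Rightarrow> nat \<Rightarrow> (int set, (int set \<times> int set) list) tquiver" where
  "Gamma_pow n m = tq_power m (Gamma_A (n * m + 2))"

definition Gamma_comp ::
  "nat \<Rightarrow> nat \<Rightarrow> int \<Rightarrow> int \<Rightarrow> (int set, (int set \<times> int set) list) tquiver" where
  "Gamma_comp n m i j = tq_component (Gamma_pow n m) (dgl (n * m + 2) i j)"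

text \<open>\<open>\<Gamma>\<^sup>m\<close> of type \<open>A\<^sub>n\<^sub>-\<^sub>1\<close> as it sits inside the \<open>m\<close>-th power: there its arrows are the sectional
  paths between \<open>m\<close>-diagonals instead of pairs of vertices.\<close>

definition Gamma_mA_in_pow ::
  "nat \<Rightarrow> nat \<Rightarrow> (int set, (int set \<times> int set) list) tquiver" where
  "Gamma_mA_in_pow n m = tq_full_sub (Gamma_pow n m) (m_diagonals n m)"

section \<open>The translation quiver of type \<open>A\<close> on a strip\<close>

text \<open>
  Vertices are \<open>(a, k)\<close> with \<open>k\<close> the row, \<open>1 \<le> k \<le> n\<close>; the vertex \<open>(a, k)\<close> is drawn at the point
  \<open>(a + k / 2, k)\<close>, so that neighbours in a row have distance one and arrows point to the right.
\<close>

definition ZA :: "nat \<Rightarrow> (int \<times> nat, (int \<times> nat) \<times> (int \<times> nat)) tquiver" where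
  "ZA n =
     \<lparr>verts = {(a, k). 1 \<le> k \<and> k \<le> n},
      arcs = {((a, k), (a, k + 1)) | a k. 1 \<le> k \<and> k + 1 \<le> n} \<union>
             {((a, k + 1), (a + 1, k)) | a k. 1 \<le> k \<and> k + 1 \<le> n},
      tail = fst, head = snd,
      transl = (\<lambda>(a, k). (a - 1, k))\<rparr>"

definition ZA_pos :: "int \<times> nat \<Rightarrow> real \<times> real" where
  "ZA_pos = (\<lambda>(a, k). (of_int a + real k / 2, real k))"

definition ZA_tau_inv :: "int \<times> nat \<Rightarrow> int \<times> nat" where
  "ZA_tau_inv = (\<lambda>(a, k). (a + 1, k))"

definition ZA_Sigma :: "nat \<Rightarrow> int \<times> nat \<Rightarrow> int \<times> nat" where
  "ZA_Sigma n = (\<lambda>(a, k). (a + int k, n + 1 - k))"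

lemma ZA_pos_tau_inv: "ZA_pos (ZA_tau_inv v) = ZA_pos v + (1, 0)"
  by (cases v) (simp add: ZA_pos_def ZA_tau_inv_def)

text \<open>\<open>\<Sigma>\<close> moves a vertex \<open>(n + 1) / 2\<close> units to the right and reflects in the centre line.\<close>

lemma ZA_pos_Sigma:
  assumes "v \<in> verts (ZA n)" "ZA_pos v = (x, y)"
  shows "ZA_pos (ZA_Sigma n v) = (x + (real n + 1) / 2, real n + 1 - y)"
  using assms by (cases v) (auto simp: ZA_def ZA_pos_def ZA_Sigma_def of_nat_diff field_simps)

definition ZA_quotient ::
  "nat \<Rightarrow> (int \<times> nat \<Rightarrow> int \<times> nat)
     \<Rightarrow> ((int \<times> nat) set, ((int \<times> nat) \<times> (int \<times> nat)) set) tquiver" where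
  "ZA_quotient n f = tq_quotient (ZA n) f (map_prod f f)"

section \<open>Shapes\<close>

definition quotient_space :: "'x topology \<Rightarrow> ('x \<times> 'x) set \<Rightarrow> 'x set topology" where
  "quotient_space X r = topology (\<lambda>U. U \<subseteq> topspace X // r \<and> openin X (\<Union>U))"

lemma openin_quotient_space:
  assumes r: "equiv (topspace X) r"
  shows "openin (quotient_space X r) U \<longleftrightarrow> U \<subseteq> topspace X // r \<and> openin X (\<Union>U)"
proof -
  have "istopology (\<lambda>U. U \<subseteq> topspace X // r \<and> openin X (\<Union>U))"
    unfolding istopology_def
  proof (intro conjI allI impI)
    fix S T
    assume S: "S \<subseteq> topspace X // r \<and> openin X (\<Union>S)"
      and T: "T \<subseteq> topspace X // r \<and> openin X (\<Union>T)"
    have "\<Union>(S \<inter> T) = \<Union>S \<inter> \<Union>T"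
    proof
      show "\<Union>S \<inter> \<Union>T \<subseteq> \<Union>(S \<inter> T)"
      proof
        fix x assume "x \<in> \<Union>S \<inter> \<Union>T"
        then obtain A B where AB: "A \<in> S" "B \<in> T" "x \<in> A" "x \<in> B" by blast
        with S T have "A = B" using quotient_disj[OF r, of A B] by blast
        with AB show "x \<in> \<Union>(S \<inter> T)" by blast
      qed
    qed blast
    with S T show "openin X (\<Union>(S \<inter> T))" by (simp add: openin_Int)
    from S show "S \<inter> T \<subseteq> topspace X // r" by blast
  next
    fix K assume K: "\<forall>S\<in>K. S \<subseteq> topspace X // r \<and> openin X (\<Union>S)"
    then show "\<Union>K \<subseteq> topspace X // r" by blast
    have "\<Union>(\<Union>K) = (\<Union>S\<in>K. \<Union>S)" by blast
    with K show "openin X (\<Union>(\<Union>K))" by auto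
  qed
  then show ?thesis by (simp add: quotient_space_def)
qed

text \<open>The strip between the bottom row and the top row of the drawing of \<open>ZA n\<close>.\<close>

definition strip :: "nat \<Rightarrow> (real \<times> real) set" where
  "strip n = UNIV \<times> {1..real n}"

text \<open>
  \<open>Q\<close> has the shape of \<open>X\<close>: it is a quotient of \<open>ZA n\<close> by an automorphism \<open>f\<close> which is the restriction
  of an isometry \<open>F\<close> of the strip (with respect to the drawing), and the quotient of the strip by the
  group generated by \<open>F\<close>, on which \<open>Q\<close> is thereby drawn, is homeomorphic to \<open>X\<close>.
\<close>

definition has_shape :: "nat \<Rightarrow> ('v, 'a) tquiver \<Rightarrow> 'x topology \<Rightarrow> bool" where
  "has_shape n Q X \<longleftrightarrow>
     (\<exists>f F. tq_iso f (map_prod f f) (ZA n) (ZA n) \<and>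
        tq_isomorphic Q (ZA_quotient n f) \<and>
        F ` strip n = strip n \<and>
        (\<forall>p \<in> strip n. \<forall>q \<in> strip n. dist (F p) (F q) = dist p q) \<and>
        (\<forall>v \<in> verts (ZA n). F (ZA_pos v) = ZA_pos (f v)) \<and>
        quotient_space (top_of_set (strip n)) (orbit_rel (strip n) F) homeomorphic_space X)"

text \<open>The bands have the height of the strip; for \<open>n = 1\<close> both degenerate to a circle.\<close>

definition cylinder :: "nat \<Rightarrow> (complex \<times> real) topology" where
  "cylinder n = prod_topology (top_of_set (sphere 0 1)) (top_of_set {1..real n})"

definition moebius_band :: "nat \<Rightarrow> (real \<times> real) set topology" where
  "moebius_band n =
     quotient_space (top_of_set ({0..1} \<times> {1..real n}))
       {(p, q). p \<in> {0..1} \<times> {1..real n} \<and> q \<in> {0..1} \<times> {1..real n} \<and>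
          (p = q \<or> (\<exists>y. {p, q} = {(0, y), (1, real n + 1 - y)}))}"

end

theory Submission
  imports Defs
begin

text \<open>
  A diagonal is an oriented chord, given by its first end point \<open>i\<close> and its length \<open>d\<close> with
  \<open>2 \<le> d \<le> N - 2\<close>, up to the flip \<open>(i, d) \<mapsto> (i + d, N - d)\<close>. In these coordinates the arrows of the
  \<open>m\<close>-th power are \<open>(i, d) \<rightarrow> (i, d + m)\<close> and \<open>(i, d) \<rightarrow> (i + m, d - m)\<close>, so that before the flip is
  divided out, the residues of \<open>i\<close> and \<open>d\<close> modulo \<open>m\<close> separate the components. The residue class \<open>1\<close>
  of \<open>d\<close> is that of the \<open>m\<close>-diagonals; each of the others has \<open>n\<close> rows and unrolls to a copy of
  \<open>ZA n\<close>. The flip sends the class \<open>c\<close> of \<open>d\<close> to \<open>m + 2 - c\<close> and its square moves \<open>i\<close> by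
  \<open>N\<close>, which is \<open>2\<close> modulo \<open>m\<close>: this leaves two components for every pair \<open>{c, m + 2 - c}\<close>, told apart
  by the parity of \<open>i\<close>. For the self-dual class \<open>c = m / 2 + 1\<close> the flip itself moves \<open>i\<close> by a number
  congruent to \<open>m / 2 + 1\<close>. If \<open>m / 2\<close> is even, it joins the two parities; if \<open>m / 2\<close> is odd, an odd
  power of it maps the sheet \<open>ZA n\<close> to itself by a glide reflection, and a Moebius band arises.
\<close>

section \<open>Quotients of translation quivers\<close>

text \<open>Quotients are handled through their projections: once an orbit relation is the kernel of
  a surjection onto \<open>W\<close>, its classes are the fibres and \<open>W\<close> indexes them.
  This serves vertices, arrows and topological quotients alike.\<close>

lemma bij_betw_fibres:
  assumes "p ` V = W"
  shows "bij_betw (\<lambda>x. {v \<in> V. p v = x}) W (V // {(v, w) \<in> V \<times> V. p v = p w})"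
proof (rule bij_betw_imageI)
  show "inj_on (\<lambda>x. {v \<in> V. p v = x}) W"
    using assms by (auto simp: inj_on_def)
  have "{v \<in> V. p v = p u} = {(v, w) \<in> V \<times> V. p v = p w} `` {u}" if "u \<in> V" for u
    using that by auto
  then show "(\<lambda>x. {v \<in> V. p v = x}) ` W = V // {(v, w) \<in> V \<times> V. p v = p w}"
    unfolding quotient_def assms[symmetric] by auto
qed

lemma tq_iso_id: "tq_iso (\<lambda>x. x) (\<lambda>x. x) Q Q"
  by (simp add: tq_iso_def bij_betw_def)

lemma tq_iso_comp:
  assumes "tq_iso f g Q R" "tq_iso f' g' R S"
  shows "tq_iso (f' \<circ> f) (g' \<circ> g) Q S"
  using assms unfolding tq_iso_def
  by (auto intro: bij_betw_trans simp: bij_betw_apply)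

lemma tq_iso_funpow:
  assumes "tq_iso f g Q Q"
  shows "tq_iso (f ^^ k) (g ^^ k) Q Q"
proof (induction k)
  case 0
  show ?case using tq_iso_id by (simp add: id_def)
next
  case (Suc k)
  then show ?case using tq_iso_comp[OF Suc assms] by (simp only: funpow.simps)
qed

definition tq_wf :: "('v, 'a) tquiver \<Rightarrow> bool" where
  "tq_wf Q \<longleftrightarrow> (\<forall>a \<in> arcs Q. tail Q a \<in> verts Q \<and> head Q a \<in> verts Q) \<and>
     (\<forall>x \<in> verts Q. transl Q x \<in> verts Q)"

text \<open>Well-formedness keeps tails, heads and translates in \<open>verts Q\<close>, where the
  inverse of \<open>f\<close> is controlled. Inverses occur because two points of an orbit may be
  related by a power of the automorphism in either direction.\<close>

lemma tq_iso_inverse: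
  assumes iso: "tq_iso f g Q R" and wf: "tq_wf Q"
  shows "tq_iso (the_inv_into (verts Q) f) (the_inv_into (arcs Q) g) R Q"
proof -
  let ?f = "the_inv_into (verts Q) f" and ?g = "the_inv_into (arcs Q) g"
  have f: "bij_betw f (verts Q) (verts R)" and g: "bij_betw g (arcs Q) (arcs R)"
    using iso by (auto simp: tq_iso_def)
  have fi: "?f (f x) = x" if "x \<in> verts Q" for x
    using f that by (simp add: bij_betw_def the_inv_into_f_f)
  have gi: "?g (g a) = a" if "a \<in> arcs Q" for a
    using g that by (simp add: bij_betw_def the_inv_into_f_f)
  have "\<forall>b \<in> g ` arcs Q. tail Q (?g b) = ?f (tail R b) \<and> head Q (?g b) = ?f (head R b)"
    using iso wf by (simp add: tq_iso_def tq_wf_def fi gi)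
  moreover have "\<forall>y \<in> f ` verts Q. ?f (transl R y) = transl Q (?f y)"
  proof
    fix y assume "y \<in> f ` verts Q"
    then obtain x where x: "x \<in> verts Q" "y = f x" by blast
    have "transl R y = f (transl Q x)" using iso x by (simp add: tq_iso_def)
    then show "?f (transl R y) = transl Q (?f y)"
      using x wf by (simp add: tq_wf_def fi)
  qed
  ultimately show ?thesis
    using f g unfolding tq_iso_def
    by (auto simp: bij_betw_the_inv_into bij_betw_imp_surj_on)
qed

definition tq_ends :: "('v, 'a) tquiver \<Rightarrow> 'a \<Rightarrow> 'v \<times> 'v" where
  "tq_ends Q a = (tail Q a, head Q a)"

text \<open>
  The map \<open>p\<close> is a covering with deck group generated by \<open>f\<close>. Since \<open>C\<close> has no multiple arrows, its
  arrows may be replaced by their pairs of end points.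
\<close>

lemma tq_isomorphic_quotient:
  fixes P :: "('v, 'a) tquiver" and C :: "('w, 'b) tquiver"
  assumes iso: "tq_iso f g P P" and wf: "tq_wf P"
    and simple: "inj_on (tq_ends C) (arcs C)"
    and arcs: "tq_ends C ` arcs C = (map_prod p p \<circ> tq_ends P) ` arcs P"
    and verts: "p ` verts P = verts C"
    and transl: "\<And>v. v \<in> verts P \<Longrightarrow> p (transl P v) = transl C (p v)"
    and ker: "\<And>v w. v \<in> verts P \<Longrightarrow> w \<in> verts P \<Longrightarrow>
       p v = p w \<longleftrightarrow> (\<exists>k. (f ^^ k) v = w \<or> (f ^^ k) w = v)"
    and unique_lift: "\<And>a b. a \<in> arcs P \<Longrightarrow> b \<in> arcs P \<Longrightarrow> tail P a = tail P b \<Longrightarrow>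
       p (head P a) = p (head P b) \<Longrightarrow> a = b"
  shows "tq_isomorphic C (tq_quotient P f g)"
proof -
  have pow: "tq_iso (f ^^ k) (g ^^ k) P P" for k
    using iso by (rule tq_iso_funpow)
  have fV: "(f ^^ k) v \<in> verts P" if "v \<in> verts P" for v k
    using pow[of k] that by (auto simp: tq_iso_def bij_betw_def)
  have pf: "p ((f ^^ k) v) = p v" if "v \<in> verts P" for v k
    using ker[OF that fV[OF that]] by metis
  have gA: "(g ^^ k) a \<in> arcs P" "tail P ((g ^^ k) a) = (f ^^ k) (tail P a)"
    "head P ((g ^^ k) a) = (f ^^ k) (head P a)" if "a \<in> arcs P" for a k
    using pow[of k] that by (auto simp: tq_iso_def bij_betw_def)
  have wfA: "tail P a \<in> verts P" "head P a \<in> verts P" if "a \<in> arcs P" for a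
    using wf that by (auto simp: tq_wf_def)
  have orbV: "orbit_rel (verts P) f = {(v, w) \<in> verts P \<times> verts P. p v = p w}"
    using ker by (auto simp: orbit_rel_def)
  \<comment> \<open>Deck transformations act transitively on each fibre: either a power of
    \<open>f\<close> carries \<open>v\<close> to \<open>w\<close>, or the inverse of one
    does.\<close>
  have deck: "\<exists>f' g'. tq_iso f' g' P P \<and> f' v = w \<and> (\<forall>x \<in> verts P. p (f' x) = p x)"
    if vw: "v \<in> verts P" "w \<in> verts P" "p v = p w" for v w
  proof -
    consider k where "(f ^^ k) v = w" | k where "(f ^^ k) w = v"
      using ker vw by blast
    then show ?thesis
    proof cases
      case 1
      then show ?thesis using pow pf by blast
    next
      case 2
      let ?h = "the_inv_into (verts P) (f ^^ k)"
      have bij: "bij_betw (f ^^ k) (verts P) (verts P)"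
        using pow by (simp add: tq_iso_def)
      have "?h v = w"
        using bij 2 vw by (metis bij_betw_def the_inv_into_f_f)
      moreover have "p (?h x) = p x" if "x \<in> verts P" for x
        using pf[of "?h x" k] bij that
        by (metis bij_betwE bij_betw_the_inv_into f_the_inv_into_f_bij_betw)
      ultimately show ?thesis
        using tq_iso_inverse[OF pow wf] by blast
    qed
  qed
  define q where "q = map_prod p p \<circ> tq_ends P"
  have q: "q a = (p (tail P a), p (head P a))" for a
    by (simp add: q_def tq_ends_def)
  \<comment> \<open>Both \<open>(g ^^ k) a\<close> and \<open>b\<close> lift the same arrow from the
    same tail, so unique lifting identifies them.\<close>
  have orbA1: "\<exists>k. (g ^^ k) a = b"
    if "a \<in> arcs P" "b \<in> arcs P" "q a = q b" "(f ^^ k) (tail P a) = tail P b" for a b k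
  proof -
    have "(g ^^ k) a = b"
      using that by (intro unique_lift) (auto simp: gA q pf wfA)
    then show ?thesis by blast
  qed
  have "(\<exists>k. (g ^^ k) a = b \<or> (g ^^ k) b = a) \<longleftrightarrow> q a = q b"
    if ab: "a \<in> arcs P" "b \<in> arcs P" for a b
  proof
    assume "\<exists>k. (g ^^ k) a = b \<or> (g ^^ k) b = a"
    then show "q a = q b" using ab by (auto simp: q gA pf wfA)
  next
    assume eq: "q a = q b"
    then obtain k where "(f ^^ k) (tail P a) = tail P b \<or> (f ^^ k) (tail P b) = tail P a"
      using ker[OF wfA(1) wfA(1)] ab by (auto simp: q)
    then show "\<exists>k. (g ^^ k) a = b \<or> (g ^^ k) b = a"
      using orbA1 ab eq by metis
  qed
  then have orbA: "orbit_rel (arcs P) g = {(a, b) \<in> arcs P \<times> arcs P. q a = q b}"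
    by (auto simp: orbit_rel_def)
  let ?F = "\<lambda>x. {v \<in> verts P. p v = x}"
  let ?G = "\<lambda>e. {a \<in> arcs P. q a = e}"
  have F: "bij_betw ?F (verts C) (verts P // orbit_rel (verts P) f)"
    unfolding orbV by (rule bij_betw_fibres) (rule verts)
  have "bij_betw (tq_ends C) (arcs C) (q ` arcs P)"
    using simple arcs by (simp add: bij_betw_def q_def)
  then have G: "bij_betw (?G \<circ> tq_ends C) (arcs C) (arcs P // orbit_rel (arcs P) g)"
    unfolding orbA by (rule bij_betw_trans) (rule bij_betw_fibres, rule refl)
  \<comment> \<open>The tails of all lifts of an arrow fill the whole fibre, since deck
    transformations carry one lift \<open>b\<close> to a lift starting at any prescribed point;
    likewise for the heads.\<close>
  have ends: "tail P ` ?G (tq_ends C a) = ?F (tail C a) \<and> head P ` ?G (tq_ends C a) = ?F (head C a)"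
    if a: "a \<in> arcs C" for a
  proof -
    have "tq_ends C a \<in> q ` arcs P" using a arcs by (auto simp: q_def)
    then obtain b where b: "b \<in> arcs P" "tail C a = p (tail P b)" "head C a = p (head P b)"
      by (auto simp: tq_ends_def q)
    have "\<exists>b' \<in> arcs P. q b' = q b \<and> tail P b' = v" if v: "v \<in> verts P" "p v = p (tail P b)" for v
    proof -
      obtain f' g' where "tq_iso f' g' P P" "f' (tail P b) = v" "\<forall>x \<in> verts P. p (f' x) = p x"
        using deck[of "tail P b" v] v b wfA by auto
      then show ?thesis using b wfA[OF b(1)] by (intro bexI[of _ "g' b"]) (auto simp: tq_iso_def q bij_betw_apply)
    qed
    moreover have "\<exists>b' \<in> arcs P. q b' = q b \<and> head P b' = v"
      if v: "v \<in> verts P" "p v = p (head P b)" for v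
    proof -
      obtain f' g' where "tq_iso f' g' P P" "f' (head P b) = v" "\<forall>x \<in> verts P. p (f' x) = p x"
        using deck[of "head P b" v] v b wfA by auto
      then show ?thesis using b wfA[OF b(1)] by (intro bexI[of _ "g' b"]) (auto simp: tq_iso_def q bij_betw_apply)
    qed
    moreover have "tq_ends C a = q b" by (simp add: tq_ends_def q b)
    ultimately show ?thesis
      unfolding b by (auto simp: image_iff q wfA)
  qed
  have trans: "?F (transl C x) = transl P ` ?F x" if x: "x \<in> verts C" for x
  proof -
    obtain v where v: "v \<in> verts P" "x = p v" using x verts by blast
    have tv: "transl P w \<in> verts P" if "w \<in> verts P" for w using wf that by (auto simp: tq_wf_def)
    show ?thesis
    proof (intro equalityI subsetI)
      fix w assume "w \<in> ?F (transl C x)"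
      then obtain f' g' where f': "tq_iso f' g' P P" "f' (transl P v) = w" "\<forall>x \<in> verts P. p (f' x) = p x"
        using deck[of "transl P v" w] v tv transl by auto
      then have "w = transl P (f' v)" "f' v \<in> verts P" "p (f' v) = x"
        using v by (auto simp: tq_iso_def bij_betw_apply)
      then show "w \<in> transl P ` ?F x" by blast
    qed (use v tv transl in auto)
  qed
  have "tq_iso ?F (?G \<circ> tq_ends C) C (tq_quotient P f g)"
    unfolding tq_iso_def
  proof (intro conjI ballI)
    show "bij_betw ?F (verts C) (verts (tq_quotient P f g))"
      using F by (simp add: tq_quotient_def)
    show "bij_betw (?G \<circ> tq_ends C) (arcs C) (arcs (tq_quotient P f g))"
      using G by (simp add: tq_quotient_def)
  qed (use ends trans in \<open>auto simp: tq_quotient_def\<close>)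
  then show ?thesis unfolding tq_isomorphic_def by blast
qed

section \<open>Diagonals and sectional paths\<close>

definition chord :: "nat \<Rightarrow> int \<Rightarrow> int \<Rightarrow> int set" where
  "chord N i d = dgl N i (i + d)"

lemma dgl_eq_chord: "dgl N i j = chord N i ((j - i) mod int N)"
  by (simp add: chord_def dgl_def mod_simps)

lemma dvd_small_eq_0:
  fixes a x :: int
  assumes "a dvd x" "\<bar>x\<bar> < a"
  shows "x = 0"
  using assms by (meson dvd_imp_le_int not_le dual_order.strict_trans1 abs_ge_self)

text \<open>Two pairs of end points agree in the same or in the opposite order. The bounds turn the
  resulting congruence between the lengths into an equality.\<close>

lemma chord_eq_iff:
  assumes "0 < d" "d < int N" "0 < d'" "d' < int N"
  shows "chord N i d = chord N i' d' \<longleftrightarrow>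
    (int N dvd i - i' \<and> d = d') \<or> (int N dvd i - i' - d' \<and> d = int N - d')"
proof -
  have "chord N i d = chord N i' d' \<longleftrightarrow>
    (int N dvd i - i' \<and> int N dvd (i + d) - (i' + d')) \<or>
    (int N dvd i - (i' + d') \<and> int N dvd (i + d) - i')"
    by (simp add: chord_def dgl_def doubleton_eq_iff mod_eq_dvd_iff)
  moreover have "int N dvd (i + d) - (i' + d') \<longleftrightarrow> d = d'" if 1: "int N dvd i - i'"
  proof
    assume "int N dvd (i + d) - (i' + d')"
    then have "int N dvd ((i + d) - (i' + d')) - (i - i')" using 1 by (rule dvd_diff)
    then have "int N dvd d - d'" by (simp add: algebra_simps)
    then have "d - d' = 0" by (rule dvd_small_eq_0) (use assms in auto)
    then show "d = d'" by simp
  qed (use 1 in \<open>simp add: algebra_simps\<close>)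
  moreover have "int N dvd (i + d) - i' \<longleftrightarrow> d = int N - d'" if 2: "int N dvd i - (i' + d')"
  proof
    assume "int N dvd (i + d) - i'"
    then have "int N dvd ((i + d) - i') - (i - (i' + d')) - int N" using 2 by (rule dvd_diff[OF dvd_diff dvd_refl])
    then have "int N dvd d + d' - int N" by (simp add: algebra_simps)
    then have "d + d' - int N = 0" by (rule dvd_small_eq_0) (use assms in auto)
    then show "d = int N - d'" by simp
  next
    assume "d = int N - d'"
    then have "(i + d) - i' = (i - (i' + d')) + int N" by simp
    then show "int N dvd (i + d) - i'" using 2 by (metis dvd_add dvd_refl)
  qed
  ultimately show ?thesis by (auto simp: algebra_simps)
qed

lemma chord_shift: "int N dvd i - i' \<Longrightarrow> chord N i d = chord N i' d"
  by (metis chord_def dgl_def mod_add_cong mod_eq_dvd_iff)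

lemma chord_flip: "chord N (i + d) (int N - d) = chord N i d"
  by (auto simp: chord_def dgl_def)

lemma rotate_chord: "rotate_dgl N c (chord N i d) = chord N (i + c) d"
  by (simp add: rotate_dgl_def chord_def dgl_def mod_simps algebra_simps)

lemma rotate_chord_funpow: "(rotate_dgl N c ^^ s) (chord N i d) = chord N (i + int s * c) d"
  by (induction s) (simp_all add: rotate_chord algebra_simps)

text \<open>The residues of \<open>j - i\<close> to be excluded are 0, 1 and \<open>N - 1\<close>;
  the last one appears in the definition as residue 1 of \<open>i - j\<close>.\<close>

lemma diagonals_eq:
  assumes "2 \<le> N"
  shows "diagonals N = {chord N i d | i d. 2 \<le> d \<and> d \<le> int N - 2}"
proof (intro equalityI subsetI)
  fix x assume "x \<in> diagonals N"
  then obtain i j where x: "x = dgl N i j" and "(j - i) mod int N \<noteq> 0"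
    "(j - i) mod int N \<noteq> 1 mod int N" and ne: "(i - j) mod int N \<noteq> 1 mod int N"
    unfolding diagonals_def by blast
  moreover have "1 mod int N = 1" using assms by simp
  moreover have "(i - j) mod int N = 1" if "(j - i) mod int N = int N - 1"
    using that assms zmod_zminus1_eq_if[of "j - i" "int N"] by auto
  moreover have "0 \<le> (j - i) mod int N" "(j - i) mod int N < int N" using assms by auto
  ultimately have "2 \<le> (j - i) mod int N \<and> (j - i) mod int N \<le> int N - 2" by force
  then show "x \<in> {chord N i d | i d. 2 \<le> d \<and> d \<le> int N - 2}"
    unfolding x dgl_eq_chord by blast
next
  fix x assume "x \<in> {chord N i d | i d. 2 \<le> d \<and> d \<le> int N - 2}"
  then obtain i d where x: "x = chord N i d" and d: "2 \<le> d" "d \<le> int N - 2" by blast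
  have "(- d) mod int N = int N - d"
    using d by (simp add: zmod_zminus1_eq_if)
  then show "x \<in> diagonals N"
    unfolding diagonals_def x chord_def using d by (intro CollectI exI[of _ i] exI[of _ "i + d"]) auto
qed

lemma chord_mem_diagonals:
  assumes "2 \<le> N"
  shows "chord N i d \<in> diagonals N \<longleftrightarrow> 2 \<le> d mod int N \<and> d mod int N \<le> int N - 2"
proof
  have eq: "chord N i d = chord N i (d mod int N)"
    by (metis chord_def dgl_eq_chord add_diff_cancel_left')
  assume "chord N i d \<in> diagonals N"
  then obtain i' d' where *: "chord N i d = chord N i' d'" "2 \<le> d'" "d' \<le> int N - 2"
    unfolding diagonals_eq[OF assms] by blast
  \<comment> \<open>\<open>chord_eq_iff\<close> needs a positive length, so residue 0, which would
    make the chord a single point, is ruled out first.\<close>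
  have "d mod int N \<noteq> 0"
  proof
    assume "d mod int N = 0"
    then have "chord N i' d' = {i mod int N}"
      using * unfolding eq by (simp add: chord_def dgl_def)
    then have "int N dvd (i' + d') - i'"
      unfolding chord_def dgl_def mod_eq_dvd_iff[symmetric] by auto
    then show False using *(2,3) dvd_small_eq_0[of "int N" d'] by auto
  qed
  moreover have "0 \<le> d mod int N" "d mod int N < int N" using assms by auto
  ultimately have "0 < d mod int N" "d mod int N < int N" by linarith+
  then show "2 \<le> d mod int N \<and> d mod int N \<le> int N - 2"
    using * unfolding eq by (subst (asm) chord_eq_iff) auto
next
  assume "2 \<le> d mod int N \<and> d mod int N \<le> int N - 2"
  moreover have eq: "chord N i d = chord N i (d mod int N)"
    by (metis chord_def dgl_eq_chord add_diff_cancel_left')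
  ultimately show "chord N i d \<in> diagonals N"
    unfolding diagonals_eq[OF assms] by blast
qed

text \<open>Orienting the diagonal so that the moving end point comes second makes both kinds of
  arrow add \<open>s\<close> to the length. Used with \<open>s = 1\<close> for
  \<open>Gamma_A\<close> and \<open>s = m\<close> for \<open>Gamma_mA\<close>.\<close>

lemma dgl_arrow:
  assumes N: "2 \<le> N" and "dgl N i j \<in> diagonals N"
    and y: "y = dgl N i (j + s) \<or> y = dgl N (i + s) j"
  obtains i' d where "dgl N i j = chord N i' d" "y = chord N i' (d + s)" "2 \<le> d" "d \<le> int N - 2"
proof -
  define d where "d = (j - i) mod int N"
  have x: "dgl N i j = chord N i d" by (simp add: dgl_eq_chord d_def)
  have "2 \<le> d mod int N \<and> d mod int N \<le> int N - 2"
    using assms(2) N unfolding x by (subst (asm) chord_mem_diagonals) auto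
  then have d: "2 \<le> d" "d \<le> int N - 2" by (simp_all add: d_def)
  have j: "j mod int N = (i + d) mod int N" by (simp add: d_def mod_simps)
  from y show ?thesis
  proof
    assume "y = dgl N i (j + s)"
    moreover have "(j + s) mod int N = (i + (d + s)) mod int N"
      using j by (metis add.assoc mod_add_left_eq)
    ultimately have "y = chord N i (d + s)" by (simp add: chord_def dgl_def)
    then show ?thesis using that x d by blast
  next
    assume "y = dgl N (i + s) j"
    moreover have "(i + s) mod int N = (i + d + (int N - d + s)) mod int N"
    proof -
      have "i + d + (int N - d + s) = (i + s) + int N" by simp
      then show ?thesis by (simp only: mod_add_self2)
    qed
    ultimately have "y = chord N (i + d) (int N - d + s)"
      using j by (simp only: chord_def dgl_def insert_commute)
    then show ?thesis
      using that[of "i + d" "int N - d"] x d by (simp add: chord_flip)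
  qed
qed

text \<open>By \<open>chord_flip\<close>, the arrows that move the other end point are included.\<close>

definition steps :: "nat \<Rightarrow> int \<Rightarrow> (int set \<times> int set) set" where
  "steps N s = {(chord N i d, chord N i (d + s)) | i d. 2 \<le> d \<and> d + s \<le> int N - 2}"

lemma steps_up: "2 \<le> d \<Longrightarrow> d + s \<le> int N - 2 \<Longrightarrow> (chord N i d, chord N i (d + s)) \<in> steps N s"
  by (auto simp: steps_def)

text \<open>Advancing the first end point by \<open>s\<close> shortens the chord by
  \<open>s\<close>. On the flipped chord this is the defining kind of step.\<close>

lemma steps_down:
  assumes "2 \<le> d - s" "d \<le> int N - 2"
  shows "(chord N i d, chord N (i + s) (d - s)) \<in> steps N s"
proof -
  have "(chord N (i + d) (int N - d), chord N (i + d) (int N - d + s)) \<in> steps N s"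
    using assms by (intro steps_up) auto
  moreover have "chord N (i + d) (int N - d + s) = chord N (i + s) (d - s)"
    using chord_flip[of N "i + s" "d - s"] by (simp add: algebra_simps)
  ultimately show ?thesis by (simp add: chord_flip)
qed

text \<open>The step may be given by another representative of the source. The two alternatives of
  \<open>chord_eq_iff\<close> produce the two directions, the flipped one appearing as a move down;
  \<open>0 \<le> s\<close> keeps \<open>d'\<close> in the range that \<open>chord_eq_iff\<close>
  requires.\<close>

lemma steps_from:
  assumes "(chord N i d, y) \<in> steps N s" "0 \<le> s" "2 \<le> d" "d \<le> int N - 2"
  shows "y = chord N i (d + s) \<and> d + s \<le> int N - 2 \<or> y = chord N (i + s) (d - s) \<and> 2 \<le> d - s"
proof -
  obtain i' d' where *: "chord N i d = chord N i' d'" "y = chord N i' (d' + s)"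
    "2 \<le> d'" "d' + s \<le> int N - 2"
    using assms(1) unfolding steps_def by auto
  from *(1) consider "int N dvd i - i'" "d = d'" | "int N dvd i - i' - d'" "d = int N - d'"
    using assms * by (subst (asm) chord_eq_iff) auto
  then show ?thesis
  proof cases
    case 1
    then show ?thesis using * chord_shift by metis
  next
    case 2
    have "int N dvd (i + s) - (i' + (d' + s))" using 2(1) by (simp add: algebra_simps)
    moreover have "d - s = int N - (d' + s)" using 2(2) by simp
    ultimately have "chord N (i + s) (d - s) = chord N (i' + (d' + s)) (int N - (d' + s))"
      by (metis chord_shift)
    then show ?thesis using * 2 by (simp add: chord_flip)
  qed
qed

lemma steps_to:
  assumes "(x, chord N i d) \<in> steps N s" "0 \<le> s" "2 \<le> d" "d \<le> int N - 2"
  shows "x = chord N i (d - s) \<and> 2 \<le> d - s \<or> x = chord N (i - s) (d + s) \<and> d + s \<le> int N - 2"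
proof -
  obtain i' d' where *: "chord N i d = chord N i' (d' + s)" "x = chord N i' d'"
    "2 \<le> d'" "d' + s \<le> int N - 2"
    using assms(1) unfolding steps_def by auto
  from *(1) consider "int N dvd i - i'" "d = d' + s"
    | "int N dvd i - i' - (d' + s)" "d = int N - (d' + s)"
    using assms * by (subst (asm) chord_eq_iff) auto
  then show ?thesis
  proof cases
    case 1
    then have "x = chord N i (d - s)" using *(2) chord_shift[of N i i' d'] by simp
    then show ?thesis using 1 * by auto
  next
    case 2
    have "int N dvd (i - s) - (i' + d')" using 2(1) by (simp add: algebra_simps)
    moreover have "d + s = int N - d'" using 2(2) by simp
    ultimately have "chord N (i - s) (d + s) = chord N (i' + d') (int N - d')"
      by (metis chord_shift)
    then show ?thesis using * 2 by (simp add: chord_flip)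
  qed
qed

lemma arcs_Gamma_A:
  assumes N: "2 \<le> N"
  shows "arcs (Gamma_A N) = steps N 1"
proof (intro equalityI subsetI)
  fix a assume "a \<in> arcs (Gamma_A N)"
  then obtain y i j where a: "a = (dgl N i j, y)" "dgl N i j \<in> diagonals N"
    "y \<in> diagonals N" "y = dgl N i (j + 1) \<or> y = dgl N (i + 1) j"
    by (auto simp: Gamma_A_def)
  obtain i' d where *: "dgl N i j = chord N i' d" "y = chord N i' (d + 1)" "2 \<le> d" "d \<le> int N - 2"
    by (rule dgl_arrow[OF N a(2,4)])
  \<comment> \<open>As \<open>d + 1 < N\<close>, the length is its own residue, so the bound is just
    that the target is a diagonal.\<close>
  have "d + 1 \<le> int N - 2"
    using a(3) * N by (simp add: chord_mem_diagonals)
  then show "a \<in> steps N 1" using a(1) * by (simp add: steps_up)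
next
  fix a assume "a \<in> steps N 1"
  then obtain i d where a: "a = (chord N i d, chord N i (d + 1))" "2 \<le> d" "d + 1 \<le> int N - 2"
    unfolding steps_def by blast
  have "chord N i d \<in> diagonals N" "chord N i (d + 1) \<in> diagonals N"
    using a(2,3) N by (simp_all add: chord_mem_diagonals)
  moreover have "chord N i d = dgl N i (i + d)" "chord N i (d + 1) = dgl N i ((i + d) + 1)"
    by (simp_all add: chord_def add.assoc)
  ultimately show "a \<in> arcs (Gamma_A N)"
    unfolding a(1) Gamma_A_def by auto
qed

section \<open>Sectional paths and the arrows of a power of the quiver of diagonals\<close>

definition chain :: "nat \<Rightarrow> int \<Rightarrow> int \<Rightarrow> nat \<Rightarrow> (int set \<times> int set) list" where
  "chain N i d s = map (\<lambda>t. (chord N i (d + int t), chord N i (d + int t + 1))) [0..<s]"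

lemma length_chain [simp]: "length (chain N i d s) = s"
  by (simp add: chain_def)

lemma nth_chain [simp]:
  "t < s \<Longrightarrow> chain N i d s ! t = (chord N i (d + int t), chord N i (d + int t + 1))"
  by (simp add: chain_def)

lemma chain_Suc: "chain N i d (Suc s) = chain N i d s @ [(chord N i (d + int s), chord N i (d + int s + 1))]"
  by (simp add: chain_def)

lemma chain_is_sectional_path:
  assumes N: "2 \<le> N" and "1 \<le> s" "2 \<le> d" "d + int s \<le> int N - 2"
  shows "tq_path (Gamma_A N) (chain N i d s) \<and> tq_sectional (Gamma_A N) (chain N i d s)"
proof
  have "chain N i d s \<noteq> []" using assms by (simp add: chain_def)
  moreover have "set (chain N i d s) \<subseteq> steps N 1"
    using assms by (auto simp: chain_def intro!: steps_up)
  moreover have "head (Gamma_A N) (chain N i d s ! t) = tail (Gamma_A N) (chain N i d s ! Suc t)"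
    if "Suc t < s" for t
    using that by (simp add: Gamma_A_def algebra_simps)
  ultimately show "tq_path (Gamma_A N) (chain N i d s)"
    using N by (simp add: tq_path_def arcs_Gamma_A)
  \<comment> \<open>The left side is the translate of the head two arrows on. Unflipped, the lengths
    differ by 2; flipped, \<open>N\<close> would divide \<open>1 + d + t\<close>, which lies
    strictly between 0 and \<open>N\<close>.\<close>
  have "chord N (i - 1) (d + int t + 2) \<noteq> chord N i (d + int t)" if "Suc t < s" for t
    using that assms dvd_small_eq_0[of "int N" "- 1 - (d + int t)"] by (subst chord_eq_iff) auto
  then show "tq_sectional (Gamma_A N) (chain N i d s)"
    unfolding tq_sectional_def by (simp add: Gamma_A_def rotate_chord algebra_simps)
qed

text \<open>The first arrow fixes an orientation. From then on \<open>steps_from\<close> leaves two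
  continuations: lengthening the chord further, or a move whose target is translated onto the tail
  of the preceding arrow, which sectionality forbids.\<close>

lemma sectional_path_is_chain:
  assumes N: "2 \<le> N"
  shows "tq_path (Gamma_A N) p \<Longrightarrow> tq_sectional (Gamma_A N) p \<Longrightarrow>
    \<exists>i d. 2 \<le> d \<and> d + int (length p) \<le> int N - 2 \<and> p = chain N i d (length p)"
proof (induction p rule: rev_induct)
  case Nil
  then show ?case by (simp add: tq_path_def)
next
  case (snoc a p)
  have a: "a \<in> steps N 1" using snoc.prems(1) N by (simp add: tq_path_def arcs_Gamma_A)
  show ?case
  proof (cases "p = []")
    case True
    then show ?thesis using a by (auto simp: steps_def chain_def)
  next
    case False
    have sub: "(p @ [a]) ! i = p ! i" if "i < length p" for i using that by (simp add: nth_append)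
    have "tq_path (Gamma_A N) p"
      unfolding tq_path_def
    proof (intro conjI allI impI)
      fix i assume "Suc i < length p"
      then show "head (Gamma_A N) (p ! i) = tail (Gamma_A N) (p ! Suc i)"
        using snoc.prems(1) sub unfolding tq_path_def
        by (metis Suc_lessD length_append_singleton less_SucI)
    qed (use snoc.prems(1) False in \<open>auto simp: tq_path_def\<close>)
    moreover have "tq_sectional (Gamma_A N) p"
      using snoc.prems(2) sub unfolding tq_sectional_def
      by (metis Suc_lessD length_append_singleton less_SucI)
    ultimately obtain i d where p: "2 \<le> d" "d + int (length p) \<le> int N - 2"
        "p = chain N i d (length p)"
      using snoc.IH by blast
    obtain s where s: "length p = Suc s" using False by (cases p) auto
    have ps': "p = chain N i d (Suc s)" using p(3) s by metis
    have ps: "p ! s = (chord N i (d + int s), chord N i (d + int s + 1))"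
      using p(3) s by (metis lessI nth_chain)
    have "head (Gamma_A N) (p ! s) = tail (Gamma_A N) a"
      using snoc.prems(1) s unfolding tq_path_def
      by (metis length_append_singleton lessI nth_append nth_append_length)
    then have a1: "fst a = chord N i (d + int s + 1)" by (simp add: ps Gamma_A_def)
    have "transl (Gamma_A N) (head (Gamma_A N) a) \<noteq> tail (Gamma_A N) (p ! s)"
      using snoc.prems(2) s unfolding tq_sectional_def
      by (metis length_append_singleton lessI nth_append nth_append_length)
    then have a2: "rotate_dgl N (- 1) (snd a) \<noteq> chord N i (d + int s)"
      by (simp add: ps Gamma_A_def)
    have "(chord N i (d + int s + 1), snd a) \<in> steps N 1" using a a1 by (metis prod.collapse)
    then have "snd a = chord N i (d + int s + 2) \<and> d + int s + 2 \<le> int N - 2 \<or>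
        snd a = chord N (i + 1) (d + int s)"
      using steps_from[of N i "d + int s + 1" "snd a" 1] p(1,2) s
      by (simp add: algebra_simps)
    then have "snd a = chord N i (d + int s + 2)" "d + int s + 2 \<le> int N - 2"
      using a2 rotate_chord[of N "- 1" "i + 1" "d + int s"] by force+
    then have "p @ [a] = chain N i d (length (p @ [a]))" "d + int (length (p @ [a])) \<le> int N - 2"
      using p(2) ps' s a1 by (simp_all add: chain_Suc prod_eq_iff algebra_simps)
    then show ?thesis using p(1) by blast
  qed
qed

lemma verts_Gamma_power: "verts (tq_power s (Gamma_A N)) = diagonals N"
  by (simp add: tq_power_def Gamma_A_def)

lemma transl_Gamma_power: "transl (tq_power s (Gamma_A N)) (chord N i d) = chord N (i - int s) d"
  by (simp add: tq_power_def Gamma_A_def rotate_chord_funpow)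

lemma arcs_Gamma_power:
  assumes "2 \<le> N" "1 \<le> s"
  shows "arcs (tq_power s (Gamma_A N)) = {chain N i d s | i d. 2 \<le> d \<and> d + int s \<le> int N - 2}"
proof (intro equalityI subsetI)
  fix p assume "p \<in> arcs (tq_power s (Gamma_A N))"
  then have "tq_path (Gamma_A N) p" "tq_sectional (Gamma_A N) p" "length p = s"
    by (auto simp: tq_power_def)
  then show "p \<in> {chain N i d s | i d. 2 \<le> d \<and> d + int s \<le> int N - 2}"
    using sectional_path_is_chain[OF assms(1)] by blast
next
  fix p assume "p \<in> {chain N i d s | i d. 2 \<le> d \<and> d + int s \<le> int N - 2}"
  then show "p \<in> arcs (tq_power s (Gamma_A N))"
    using chain_is_sectional_path[OF assms] by (auto simp: tq_power_def)
qed

lemma ends_chain: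
  assumes "1 \<le> s"
  shows "tq_ends (tq_power s (Gamma_A N)) (chain N i d s) = (chord N i d, chord N i (d + int s))"
proof -
  obtain t where t: "s = Suc t" using assms by (cases s) auto
  have "hd (chain N i d s) = (chord N i d, chord N i (d + 1))"
    using nth_chain[of 0 s N i d] t by (subst hd_conv_nth) (auto simp: chain_def)
  moreover have "last (chain N i d s) = (chord N i (d + int t), chord N i (d + int s))"
    using t by (simp add: chain_Suc add.commute add.left_commute)
  ultimately show ?thesis by (simp add: tq_ends_def tq_power_def Gamma_A_def)
qed

lemma ends_Gamma_power:
  assumes "2 \<le> N" "1 \<le> s"
  shows "tq_ends (tq_power s (Gamma_A N)) ` arcs (tq_power s (Gamma_A N)) = steps N (int s)"
proof -
  have "(\<lambda>p. tq_ends (tq_power s (Gamma_A N)) p) ` {chain N i d s | i d. P i d} =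
      {(chord N i d, chord N i (d + int s)) | i d. P i d}" for P
    using ends_chain[OF assms(2)] by (force simp: image_def)
  then show ?thesis unfolding arcs_Gamma_power[OF assms] steps_def by simp
qed

text \<open>A match without flip at either end already gives the same starting data. A flip at both
  ends would require \<open>d + d' = N\<close> and \<open>d + d' + 2 * s = N\<close>, contradicting
  \<open>1 \<le> s\<close>. Hence the power has no multiple arrows.\<close>

lemma inj_ends_Gamma_power:
  assumes "2 \<le> N" "1 \<le> s"
  shows "inj_on (tq_ends (tq_power s (Gamma_A N))) (arcs (tq_power s (Gamma_A N)))"
proof (rule inj_onI)
  fix p q assume "p \<in> arcs (tq_power s (Gamma_A N))" "q \<in> arcs (tq_power s (Gamma_A N))"
    and eq: "tq_ends (tq_power s (Gamma_A N)) p = tq_ends (tq_power s (Gamma_A N)) q"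
  then obtain i d i' d' where p: "p = chain N i d s" "2 \<le> d" "d + int s \<le> int N - 2"
    and q: "q = chain N i' d' s" "2 \<le> d'" "d' + int s \<le> int N - 2"
    unfolding arcs_Gamma_power[OF assms] by blast
  have 1: "chord N i d = chord N i' d'" and 2: "chord N i (d + int s) = chord N i' (d' + int s)"
    using eq assms by (simp_all add: p q ends_chain)
  have "int N dvd i - i' \<and> d = d' \<or> int N dvd i - i' - d' \<and> d = int N - d'"
    using 1 p q by (subst (asm) chord_eq_iff) auto
  moreover have "int N dvd i - i' \<and> d = d' \<or>
      int N dvd i - i' - (d' + int s) \<and> d + int s = int N - (d' + int s)"
    using 2 p q by (subst (asm) chord_eq_iff) auto
  ultimately have "int N dvd i - i' \<and> d = d'" using assms by auto
  then have "chord N i (d + t) = chord N i' (d' + t)" for t using chord_shift by blast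
  then show "p = q" unfolding p q chain_def by (simp add: add.assoc)
qed

section \<open>Quotients of the strip\<close>

text \<open>The fibre map is a bijection from \<open>Y\<close> onto the classes, and the union of a
  set of classes is the \<open>g\<close>-preimage of the corresponding subset of \<open>Y\<close>.
  So it is a bijective quotient map, that is, a homeomorphism.\<close>

lemma quotient_space_homeomorphic_image:
  assumes g: "quotient_map X Y g"
    and r: "r = {(x, y) \<in> topspace X \<times> topspace X. g x = g y}"
  shows "quotient_space X r homeomorphic_space Y"
proof -
  let ?h = "\<lambda>y. {x \<in> topspace X. g x = y}"
  have gim: "g ` topspace X = topspace Y" using g by (rule quotient_imp_surjective_map)
  have equiv: "equiv (topspace X) r"
    unfolding r by (auto simp: equiv_def refl_on_def sym_def trans_def)
  note op = openin_quotient_space[OF equiv]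
  have bij: "bij_betw ?h (topspace Y) (topspace X // r)"
    unfolding r by (rule bij_betw_fibres[OF gim])
  have "\<Union>(topspace X // r) = topspace X" using equiv by (rule Union_quotient)
  then have top: "topspace (quotient_space X r) = topspace X // r"
    using op by (metis openin_subset openin_topspace subset_antisym subset_refl)
  have "quotient_map Y (quotient_space X r) ?h"
    unfolding quotient_map_def
  proof (intro conjI allI impI)
    show "?h ` topspace Y = topspace (quotient_space X r)"
      using bij top by (simp add: bij_betw_def)
    fix U assume U: "U \<subseteq> topspace (quotient_space X r)"
    have "{x \<in> topspace X. g x \<in> {y \<in> topspace Y. ?h y \<in> U}} = \<Union>U"
    proof (intro equalityI subsetI)
      fix x assume "x \<in> \<Union>U"
      then obtain A where A: "A \<in> U" "x \<in> A" by blast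
      then have "A \<in> ?h ` topspace Y" using U bij top by (auto simp: bij_betw_def)
      then have "A = ?h (g x)" "x \<in> topspace X" using A by auto
      then show "x \<in> {x \<in> topspace X. g x \<in> {y \<in> topspace Y. ?h y \<in> U}}" using A gim by auto
    next
      fix x assume "x \<in> {x \<in> topspace X. g x \<in> {y \<in> topspace Y. ?h y \<in> U}}"
      then have "x \<in> ?h (g x)" "?h (g x) \<in> U" by auto
      then show "x \<in> \<Union>U" by (rule UnionI[rotated])
    qed
    moreover have "openin X {x \<in> topspace X. g x \<in> W} = openin Y W" if "W \<subseteq> topspace Y" for W
      using g that by (simp add: quotient_map_def)
    from this[of "{y \<in> topspace Y. ?h y \<in> U}"]
    have "openin X {x \<in> topspace X. g x \<in> {y \<in> topspace Y. ?h y \<in> U}} =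
        openin Y {y \<in> topspace Y. ?h y \<in> U}" by blast
    ultimately have "openin X (\<Union>U) = openin Y {y \<in> topspace Y. ?h y \<in> U}" by (simp only:)
    then show "openin Y {y \<in> topspace Y. ?h y \<in> U} = openin (quotient_space X r) U"
      using U op top by auto
  qed
  then have "homeomorphic_map Y (quotient_space X r) ?h"
    using bij unfolding homeomorphic_map_def bij_betw_def by blast
  then show ?thesis
    using homeomorphic_map_imp_homeomorphic_space homeomorphic_space_sym by blast
qed

text \<open>A continuous surjection from a compact space onto a Hausdorff space is a quotient map,
  and if a composite is a quotient map then so is its second factor. Thus a compact piece
  \<open>K\<close> meeting every fibre controls the non-compact strip.\<close>

lemma quotient_map_via_compact:
  fixes i :: "'a::t2_space \<Rightarrow> 'b::t2_space" and g :: "'b \<Rightarrow> 'c::t2_space"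
  assumes K: "compact K" and i: "continuous_on K i" "i ` K \<subseteq> S" and g: "continuous_on S g"
    and onto: "g ` S \<subseteq> g ` i ` K"
  shows "quotient_map (top_of_set K) (top_of_set (g ` S)) (g \<circ> i)"
    and "quotient_map (top_of_set S) (top_of_set (g ` S)) g"
proof -
  have im: "(g \<circ> i) ` K = g ` S" using i onto by (auto simp: image_comp)
  have cont: "continuous_on K (g \<circ> i)"
    using i g by (intro continuous_on_compose) (auto intro: continuous_on_subset)
  show 1: "quotient_map (top_of_set K) (top_of_set (g ` S)) (g \<circ> i)"
    unfolding quotient_map_def
  proof (intro conjI allI impI)
    fix U assume "U \<subseteq> topspace (top_of_set (g ` S))"
    then show "openin (top_of_set K) {x \<in> topspace (top_of_set K). (g \<circ> i) x \<in> U} =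
        openin (top_of_set (g ` S)) U"
      using Abstract_Topology_2.continuous_imp_quotient_map[OF cont im K, of U]
      by (simp add: vimage_def Int_def)
  qed (use im in auto)
  show "quotient_map (top_of_set S) (top_of_set (g ` S)) g"
    using i g 1 by (intro quotient_map_from_composition[of _ _ i]) auto
qed

section \<open>The strip modulo a translation or a glide reflection\<close>

lemma cis_eq_cis_iff: "cis a = cis b \<longleftrightarrow> (\<exists>k::int. a = b + 2 * pi * of_int k)"
  using sin_cos_eq_iff[of a b] by (auto simp: complex_eq_iff)

lemma orbit_rel_eqI:
  assumes "\<And>p q. p \<in> S \<Longrightarrow> q \<in> S \<Longrightarrow>
    (\<exists>k. (F ^^ k) p = q \<or> (F ^^ k) q = p) \<longleftrightarrow> g p = g q"
  shows "orbit_rel S F = {(p, q) \<in> S \<times> S. g p = g q}"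
  using assms unfolding orbit_rel_def by auto

text \<open>Winding the first coordinate around the circle with period \<open>L\<close> separates
  exactly the orbits, and one period of the strip, the image of \<open>?K\<close>, already covers
  everything.\<close>

lemma quotient_strip_cylinder:
  assumes L: "0 < L"
  shows "quotient_space (top_of_set (strip n)) (orbit_rel (strip n) (\<lambda>(x, y). (x + L, y)))
    homeomorphic_space cylinder n"
proof -
  let ?F = "\<lambda>(x::real, y::real). (x + L, y)"
  let ?K = "{0..1::real} \<times> {1..real n}"
  let ?i = "\<lambda>(s, y). (L * s, y::real)"
  let ?g = "\<lambda>(x, y). (cis (2 * pi * x / L), y::real)"
  have g_eq: "?g (x, y) = ?g (x', y') \<longleftrightarrow> y = y' \<and> (\<exists>k::int. x = x' + L * of_int k)"
    for x y x' y'
  proof -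
    have "2 * pi * x / L = 2 * pi * x' / L + 2 * pi * of_int k \<longleftrightarrow> x = x' + L * of_int k" for k :: int
    proof -
      have "2 * pi * x / L = 2 * pi * x' / L + 2 * pi * of_int k \<longleftrightarrow>
          2 * pi * x = 2 * pi * (x' + L * of_int k)"
        using L by (auto simp: field_simps)
      then show ?thesis by simp
    qed
    then show ?thesis by (auto simp: cis_eq_cis_iff)
  qed
  have img: "?g ` strip n = sphere 0 1 \<times> {1..real n}"
  proof (intro equalityI subsetI)
    fix z assume "z \<in> sphere (0::complex) 1 \<times> {1..real n}"
    then obtain w y where z: "z = (w, y)" "norm w = 1" "y \<in> {1..real n}" by auto
    then have "w = cis (Arg w)" by (metis rcis_cmod_Arg rcis_def mult_1 of_real_1)
    then have "z = ?g (L * Arg w / (2 * pi), y)" using z L by simp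
    moreover have "(L * Arg w / (2 * pi), y) \<in> strip n" using z by (simp add: strip_def)
    ultimately show "z \<in> ?g ` strip n" by (rule image_eqI)
  qed (auto simp: strip_def)
  have onto: "?g ` strip n \<subseteq> ?g ` ?i ` ?K"
  proof
    fix z assume "z \<in> ?g ` strip n"
    then obtain x y where z: "z = ?g (x, y)" "y \<in> {1..real n}" by (auto simp: strip_def)
    \<comment> \<open>Removing \<open>\<lfloor>x / L\<rfloor>\<close> full periods moves the point
      into the first one.\<close>
    have "?g (x, y) = ?g (?i (frac (x / L), y))"
      using L unfolding prod.case g_eq[unfolded prod.case]
      by (auto intro!: exI[of _ "\<lfloor>x / L\<rfloor>"] simp: frac_def field_simps g_eq[unfolded prod.case])
    moreover have "(frac (x / L), y) \<in> ?K"
      using z by (auto simp: frac_ge_0 less_imp_le frac_lt_1)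
    ultimately show "z \<in> ?g ` ?i ` ?K" using z by blast
  qed
  have "quotient_map (top_of_set (strip n)) (top_of_set (?g ` strip n)) ?g"
  proof (rule quotient_map_via_compact(2)[of ?K ?i])
    show "compact ?K" by (intro compact_Times) auto
    show "continuous_on ?K ?i" "continuous_on (strip n) ?g"
      using L by (auto simp: case_prod_beta intro!: continuous_intros)
  qed (use onto in \<open>auto simp: strip_def\<close>)
  moreover have "orbit_rel (strip n) ?F = {(p, q) \<in> strip n \<times> strip n. ?g p = ?g q}"
  proof (rule orbit_rel_eqI)
    fix p q :: "real \<times> real"
    obtain x y x' y' where pq: "p = (x, y)" "q = (x', y')" by (cases p, cases q)
    have pow: "(?F ^^ k) (a, b) = (a + L * real k, b)" for k a b
      by (induction k) (auto simp: algebra_simps)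
    have "(\<exists>k::nat. x + L * real k = x' \<or> x' + L * real k = x) \<longleftrightarrow> (\<exists>k::int. x = x' + L * of_int k)"
    proof
      assume "\<exists>k::nat. x + L * real k = x' \<or> x' + L * real k = x"
      then obtain k :: nat where "x + L * real k = x' \<or> x' + L * real k = x" by blast
      then have "x = x' + L * of_int (- int k) \<or> x = x' + L * of_int (int k)" by auto
      then show "\<exists>k::int. x = x' + L * of_int k" by blast
    next
      assume "\<exists>k::int. x = x' + L * of_int k"
      then obtain k :: int where k: "x = x' + L * of_int k" by blast
      \<comment> \<open>Only natural powers occur in \<open>orbit_rel\<close>; the sign of
        \<open>k\<close> selects which point is moved to the other.\<close>
      show "\<exists>k::nat. x + L * real k = x' \<or> x' + L * real k = x"
        by (rule exI[of _ "nat \<bar>k\<bar>"]) (use k in \<open>auto simp: abs_if\<close>)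
    qed
    then show "(\<exists>k. (?F ^^ k) p = q \<or> (?F ^^ k) q = p) \<longleftrightarrow> ?g p = ?g q"
      unfolding pq pow g_eq prod.inject by blast
  qed
  moreover have "top_of_set (?g ` strip n) = cylinder n"
    unfolding img cylinder_def by (simp add: subtopology_Times flip: euclidean_product_topology)
  ultimately show ?thesis
    using quotient_space_homeomorphic_image[of "top_of_set (strip n)" "cylinder n" ?g, OF _ refl]
    by (simp only: topspace_euclidean_subtopology)
qed

lemma cis_add_pi_int: "cis (t + pi * of_int k) = (if even k then cis t else - cis t)"
proof (cases "even k")
  case True
  then obtain j where "k = 2 * j" by blast
  then have "cis (t + pi * of_int k) = cis t"
    unfolding cis_eq_cis_iff by (intro exI[of _ j]) simp
  then show ?thesis using True by simp
next
  case False
  then obtain j where "k = 2 * j + 1" by (rule oddE)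
  then have "cis (t + pi * of_int k) = cis (t + pi)"
    unfolding cis_eq_cis_iff by (intro exI[of _ j]) (simp add: algebra_simps)
  then show ?thesis using False by (simp add: complex_eq_iff)
qed

text \<open>
  Both the quotient of the strip and the band glued from a rectangle are identified with the same
  band in \<open>\<complex> \<times> \<complex>\<close>: when \<open>x\<close> grows by \<open>L\<close>, the factor \<open>cis (pi * x / L)\<close> changes its sign, and so
  does the height above the centre line.
\<close>

lemma quotient_strip_moebius_band:
  assumes L: "0 < L"
  shows "quotient_space (top_of_set (strip n)) (orbit_rel (strip n) (\<lambda>(x, y). (x + L, real n + 1 - y)))
    homeomorphic_space moebius_band n"
proof -
  let ?F = "\<lambda>(x::real, y::real). (x + L, real n + 1 - y)"
  let ?K = "{0..1::real} \<times> {1..real n}"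
  let ?i = "\<lambda>(s, y). (L * s, y::real)"
  let ?g = "\<lambda>(x, y). (cis (2 * pi * x / L), of_real (y - (real n + 1) / 2) * cis (pi * x / L))"
  \<comment> \<open>The effect of the \<open>k\<close>-th power of \<open>?F\<close> on the height;
    it depends only on the parity of \<open>k\<close> and is its own inverse.\<close>
  define fl where "fl k y = (if even k then y else real n + 1 - y)" for k :: int and y
  have g_eq: "?g (x, y) = ?g (x', y') \<longleftrightarrow> (\<exists>k::int. x = x' + L * of_int k \<and> y = fl k y')"
    for x y x' y'
  proof -
    have 1: "2 * pi * x / L = 2 * pi * x' / L + 2 * pi * of_int k \<longleftrightarrow> x = x' + L * of_int k" for k :: int
    proof -
      have "2 * pi * x / L = 2 * pi * x' / L + 2 * pi * of_int k \<longleftrightarrow>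
          2 * pi * x = 2 * pi * (x' + L * of_int k)"
        using L by (auto simp: field_simps)
      then show ?thesis by simp
    qed
    have 2: "of_real (y - (real n + 1) / 2) * cis (pi * x / L) =
        of_real (y' - (real n + 1) / 2) * cis (pi * x' / L) \<longleftrightarrow> y = fl k y'"
      if "x = x' + L * of_int k" for k :: int
    proof -
      have "pi * x / L = pi * x' / L + pi * of_int k" using that L by (simp add: field_simps)
      then have "cis (pi * x / L) = (if even k then cis (pi * x' / L) else - cis (pi * x' / L))"
        by (simp only: cis_add_pi_int)
      then have "of_real (y - (real n + 1) / 2) * cis (pi * x / L) =
          of_real (fl k y - (real n + 1) / 2) * cis (pi * x' / L)"
        by (auto simp: fl_def field_simps)
      moreover have "fl k y - (real n + 1) / 2 = y' - (real n + 1) / 2 \<longleftrightarrow> y = fl k y'"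
        by (auto simp: fl_def)
      ultimately show ?thesis by (simp add: of_real_eq_iff del: of_real_diff of_real_divide)
    qed
    show ?thesis using 1 2 by (auto simp: cis_eq_cis_iff)
  qed
  have fl01: "fl k y \<in> {1..real n}" if "y \<in> {1..real n}" for k y
    using that by (auto simp: fl_def)
  have onto: "?g ` strip n \<subseteq> ?g ` ?i ` ?K"
  proof
    fix z assume "z \<in> ?g ` strip n"
    then obtain x y where z: "z = ?g (x, y)" "y \<in> {1..real n}" by (auto simp: strip_def)
    have "?g (x, y) = ?g (L * frac (x / L), fl \<lfloor>x / L\<rfloor> y)"
      unfolding g_eq using L
      by (intro exI[of _ "\<lfloor>x / L\<rfloor>"]) (auto simp: frac_def field_simps fl_def)
    then have "z = ?g (?i (frac (x / L), fl \<lfloor>x / L\<rfloor> y))" using z by simp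
    moreover have "(frac (x / L), fl \<lfloor>x / L\<rfloor> y) \<in> ?K"
      using z fl01 by (simp add: frac_ge_0 less_imp_le frac_lt_1)
    ultimately show "z \<in> ?g ` ?i ` ?K" by blast
  qed
  have K: "compact ?K" by (intro compact_Times) auto
  have cont: "continuous_on ?K ?i" "continuous_on (strip n) ?g"
    using L by (auto simp: case_prod_beta intro!: continuous_intros)
  have iK: "?i ` ?K \<subseteq> strip n" by (auto simp: strip_def)
  note q = quotient_map_via_compact[OF K cont(1) iK cont(2) onto]
  have "orbit_rel (strip n) ?F = {(p, q) \<in> strip n \<times> strip n. ?g p = ?g q}"
  proof (rule orbit_rel_eqI)
    fix p q :: "real \<times> real"
    obtain x y x' y' where pq: "p = (x, y)" "q = (x', y')" by (cases p, cases q)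
    have pow: "(?F ^^ k) (a, b) = (a + L * real k, fl (int k) b)" for k a b
      by (induction k) (auto simp: algebra_simps fl_def)
    have "(\<exists>k::nat. x + L * real k = x' \<and> fl (int k) y = y' \<or> x' + L * real k = x \<and> fl (int k) y' = y)
      \<longleftrightarrow> (\<exists>k::int. x = x' + L * of_int k \<and> y = fl k y')"
    proof
      assume "\<exists>k::nat. x + L * real k = x' \<and> fl (int k) y = y' \<or> x' + L * real k = x \<and> fl (int k) y' = y"
      then obtain k :: nat where
        "x + L * real k = x' \<and> fl (int k) y = y' \<or> x' + L * real k = x \<and> fl (int k) y' = y"
        by blast
      then have "x = x' + L * of_int (- int k) \<and> y = fl (- int k) y' \<or>
          x = x' + L * of_int (int k) \<and> y = fl (int k) y'"
        by (auto simp: fl_def split: if_splits)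
      then show "\<exists>k::int. x = x' + L * of_int k \<and> y = fl k y'" by blast
    next
      assume "\<exists>k::int. x = x' + L * of_int k \<and> y = fl k y'"
      then obtain k :: int where k: "x = x' + L * of_int k" "y = fl k y'" by blast
      show "\<exists>k::nat. x + L * real k = x' \<and> fl (int k) y = y' \<or> x' + L * real k = x \<and> fl (int k) y' = y"
        by (rule exI[of _ "nat \<bar>k\<bar>"]) (use k in \<open>auto simp: abs_if fl_def\<close>)
    qed
    then show "(\<exists>k. (?F ^^ k) p = q \<or> (?F ^^ k) q = p) \<longleftrightarrow> ?g p = ?g q"
      unfolding pq pow g_eq by simp
  qed
  then have 1: "quotient_space (top_of_set (strip n)) (orbit_rel (strip n) ?F)
      homeomorphic_space top_of_set (?g ` strip n)"
    using q(2) by (intro quotient_space_homeomorphic_image) auto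
  \<comment> \<open>On the rectangle the number \<open>k\<close> of periods between two identified
    points is \<open>-1\<close>, \<open>0\<close> or \<open>1\<close>, and
    \<open>k \<noteq> 0\<close> occurs only between the two vertical edges. This is the gluing in
    \<open>moebius_band\<close>.\<close>
  have "(p = q \<or> (\<exists>y. {p, q} = {(0, y), (1, real n + 1 - y)})) \<longleftrightarrow> (?g \<circ> ?i) p = (?g \<circ> ?i) q"
    if pq: "p \<in> ?K" "q \<in> ?K" for p q
  proof -
    obtain s y s' y' where pq': "p = (s, y)" "q = (s', y')" by (cases p, cases q)
    have "(?g \<circ> ?i) p = (?g \<circ> ?i) q \<longleftrightarrow> (\<exists>k::int. s = s' + of_int k \<and> y = fl k y')"
    proof -
      have "L * s = L * s' + L * t \<longleftrightarrow> s = s' + t" for t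
        using L by (metis distrib_left less_irrefl mult_left_cancel)
      then show ?thesis unfolding pq' comp_def using g_eq[of "L * s" y "L * s'" y'] by simp
    qed
    also have "\<dots> \<longleftrightarrow> (s = s' \<and> y = y') \<or> (s = 0 \<and> s' = 1 \<and> y = real n + 1 - y') \<or>
        (s = 1 \<and> s' = 0 \<and> y = real n + 1 - y')" (is "?l \<longleftrightarrow> ?r")
    proof
      assume ?l
      then obtain k :: int where k: "s = s' + of_int k" "y = fl k y'" by blast
      then have "\<bar>of_int k\<bar> \<le> (1::real)" using pq pq' by auto
      then have "k = 0 \<or> k = 1 \<or> k = - 1" by linarith
      then show ?r using k pq pq' by (auto simp: fl_def)
    next
      assume ?r
      then have "(s = s' + of_int 0 \<and> y = fl 0 y') \<or> (s = s' + of_int (- 1) \<and> y = fl (- 1) y') \<or>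
          (s = s' + of_int 1 \<and> y = fl 1 y')"
        by (auto simp: fl_def)
      then show ?l by blast
    qed
    also have "\<dots> \<longleftrightarrow> (p = q \<or> (\<exists>y. {p, q} = {(0, y), (1, real n + 1 - y)}))"
      unfolding pq' by (auto simp: doubleton_eq_iff)
    finally show ?thesis by blast
  qed
  then have "{(p, q). p \<in> ?K \<and> q \<in> ?K \<and>
      (p = q \<or> (\<exists>y. {p, q} = {(0, y), (1, real n + 1 - y)}))} =
      {(p, q) \<in> ?K \<times> ?K. (?g \<circ> ?i) p = (?g \<circ> ?i) q}" by blast
  then have "moebius_band n homeomorphic_space top_of_set (?g ` strip n)"
    unfolding moebius_band_def
    by (intro quotient_space_homeomorphic_image[OF q(1)]) (simp only: topspace_euclidean_subtopology)
  then show ?thesis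
    using 1 homeomorphic_space_sym homeomorphic_space_trans by blast
qed

section \<open>Automorphisms of the strip quiver\<close>

lemma tq_wf_ZA: "tq_wf (ZA n)"
  by (auto simp: tq_wf_def ZA_def)

lemma tq_iso_ZA:
  assumes "\<And>v. v \<in> verts (ZA n) \<Longrightarrow> f v \<in> verts (ZA n) \<and> f' (f v) = v"
    and "\<And>v. v \<in> verts (ZA n) \<Longrightarrow> f' v \<in> verts (ZA n) \<and> f (f' v) = v"
    and "\<And>v w. (v, w) \<in> arcs (ZA n) \<Longrightarrow> (f v, f w) \<in> arcs (ZA n) \<and> (f' v, f' w) \<in> arcs (ZA n)"
    and "\<And>v. v \<in> verts (ZA n) \<Longrightarrow> f (transl (ZA n) v) = transl (ZA n) (f v)"
  shows "tq_iso f (map_prod f f) (ZA n) (ZA n)"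
proof -
  have wf: "v \<in> verts (ZA n) \<and> w \<in> verts (ZA n)" if "(v, w) \<in> arcs (ZA n)" for v w
    using tq_wf_ZA[of n] that by (force simp: tq_wf_def ZA_def)
  have "bij_betw f (verts (ZA n)) (verts (ZA n))"
    using assms(1,2) by (intro bij_betw_byWitness[where f' = f']) auto
  moreover have "bij_betw (map_prod f f) (arcs (ZA n)) (arcs (ZA n))"
    using assms(1-3) wf by (intro bij_betw_byWitness[where f' = "map_prod f' f'"]) auto
  moreover have "tail (ZA n) = fst" "head (ZA n) = snd" by (simp_all add: ZA_def)
  ultimately show ?thesis using assms(4) by (simp add: tq_iso_def)
qed

definition ZA_shift :: "int \<Rightarrow> int \<times> nat \<Rightarrow> int \<times> nat" where
  "ZA_shift q = (\<lambda>(a, k). (a + q, k))"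

text \<open>In the drawing this is a glide reflection with displacement
  \<open>q + (n + 1) / 2\<close>. For natural \<open>q\<close> it is \<open>ZA_Sigma n\<close>
  followed by \<open>ZA_tau_inv ^^ q\<close>.\<close>

definition ZA_glide :: "nat \<Rightarrow> int \<Rightarrow> int \<times> nat \<Rightarrow> int \<times> nat" where
  "ZA_glide n q = (\<lambda>(a, k). (a + q + int k, n + 1 - k))"

lemma tq_iso_ZA_shift: "tq_iso (ZA_shift q) (map_prod (ZA_shift q) (ZA_shift q)) (ZA n) (ZA n)"
  by (rule tq_iso_ZA[where f' = "ZA_shift (- q)"]) (auto simp: ZA_shift_def ZA_def)

text \<open>Reflecting the rows exchanges the ascending and the descending arrows; the summand
  \<open>int k\<close> in the column makes the columns fit.\<close>

lemma tq_iso_ZA_glide: "tq_iso (ZA_glide n q) (map_prod (ZA_glide n q) (ZA_glide n q)) (ZA n) (ZA n)"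
proof (rule tq_iso_ZA[where f' = "\<lambda>(a, k). (a - q - int (n + 1 - k), n + 1 - k)"])
  fix v w assume "(v, w) \<in> arcs (ZA n)"
  then consider a k where "v = (a, k)" "w = (a, k + 1)" "1 \<le> k" "k + 1 \<le> n"
    | a k where "v = (a, k + 1)" "w = (a + 1, k)" "1 \<le> k" "k + 1 \<le> n"
    by (auto simp: ZA_def)
  then show "(ZA_glide n q v, ZA_glide n q w) \<in> arcs (ZA n) \<and>
      (case v of (a, k) \<Rightarrow> (a - q - int (n + 1 - k), n + 1 - k),
       case w of (a, k) \<Rightarrow> (a - q - int (n + 1 - k), n + 1 - k)) \<in> arcs (ZA n)"
    by cases (auto simp: ZA_def ZA_glide_def of_nat_diff Suc_diff_le)
qed (auto simp: ZA_glide_def ZA_def of_nat_diff)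

lemma dist_prod_translate: "dist (x + c, y) (x' + c, y') = dist (x, y) (x', y')"
  for x x' c :: real and y y' :: real
  by (simp add: dist_prod_def)

lemma has_shape_cylinder:
  assumes "0 < q" and iso: "tq_isomorphic Q (ZA_quotient n (ZA_shift q))"
  shows "has_shape n Q (cylinder n)"
  unfolding has_shape_def
proof (intro exI conjI)
  let ?F = "\<lambda>(x::real, y::real). (x + of_int q, y)"
  show "tq_iso (ZA_shift q) (map_prod (ZA_shift q) (ZA_shift q)) (ZA n) (ZA n)"
    by (rule tq_iso_ZA_shift)
  show "?F ` strip n = strip n"
  proof (intro equalityI subsetI)
    fix p assume "p \<in> strip n"
    then obtain x y where "p = (x, y)" "y \<in> {1..real n}" by (auto simp: strip_def)
    then show "p \<in> ?F ` strip n"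
      by (intro image_eqI[of _ _ "(x - of_int q, y)"]) (auto simp: strip_def)
  qed (auto simp: strip_def)
  show "\<forall>p \<in> strip n. \<forall>r \<in> strip n. dist (?F p) (?F r) = dist p r"
    by (auto simp: dist_prod_translate)
  show "\<forall>v \<in> verts (ZA n). ?F (ZA_pos v) = ZA_pos (ZA_shift q v)"
    by (auto simp: ZA_pos_def ZA_shift_def)
  show "quotient_space (top_of_set (strip n)) (orbit_rel (strip n) ?F) homeomorphic_space cylinder n"
    using assms by (intro quotient_strip_cylinder) simp
qed (rule iso)

lemma has_shape_moebius_band:
  assumes "0 \<le> q" and iso: "tq_isomorphic Q (ZA_quotient n (ZA_glide n q))"
  shows "has_shape n Q (moebius_band n)"
  unfolding has_shape_def
proof (intro exI conjI)
  \<comment> \<open>The displacement of the glide in drawn coordinates, where row \<open>k\<close>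
    is offset by \<open>k / 2\<close>; it is positive because \<open>0 \<le> q\<close>.\<close>
  let ?L = "of_int q + (real n + 1) / 2"
  let ?F = "\<lambda>(x::real, y::real). (x + ?L, real n + 1 - y)"
  show "tq_iso (ZA_glide n q) (map_prod (ZA_glide n q) (ZA_glide n q)) (ZA n) (ZA n)"
    by (rule tq_iso_ZA_glide)
  show "?F ` strip n = strip n"
  proof (intro equalityI subsetI)
    fix p assume "p \<in> strip n"
    then obtain x y where "p = (x, y)" "y \<in> {1..real n}" by (auto simp: strip_def)
    then show "p \<in> ?F ` strip n"
      by (intro image_eqI[of _ _ "(x - ?L, real n + 1 - y)"]) (auto simp: strip_def)
  qed (auto simp: strip_def)
  show "\<forall>p \<in> strip n. \<forall>r \<in> strip n. dist (?F p) (?F r) = dist p r"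
    by (auto simp: dist_prod_def dist_real_def power2_commute)
  show "\<forall>v \<in> verts (ZA n). ?F (ZA_pos v) = ZA_pos (ZA_glide n q v)"
    by (auto simp: ZA_pos_def ZA_glide_def ZA_def of_nat_diff field_simps)
  show "quotient_space (top_of_set (strip n)) (orbit_rel (strip n) ?F) homeomorphic_space moebius_band n"
    using assms by (intro quotient_strip_moebius_band) (simp add: add_nonneg_pos)
qed (rule iso)

section \<open>Orbits of shifts and glides, and their expression by the translation and the shift
  functor\<close>

lemma orbit_rel_cong:
  assumes "\<And>v. v \<in> V \<Longrightarrow> f v = f' v" "\<And>v. v \<in> V \<Longrightarrow> f' v \<in> V"
  shows "orbit_rel V f = orbit_rel V f'"
proof -
  have "(f ^^ k) v = (f' ^^ k) v \<and> (f' ^^ k) v \<in> V" if "v \<in> V" for v k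
    using that by (induction k) (auto simp: assms)
  then show ?thesis by (auto simp: orbit_rel_def)
qed

text \<open>\<open>ZA_Sigma n\<close> truncates \<open>n + 1 - k\<close> in rows beyond
  \<open>n + 1\<close>, so its square is not a shift on all pairs. Hence automorphisms are compared
  on the vertices of \<open>ZA n\<close> only.\<close>

lemma ZA_quotient_cong:
  assumes eq: "\<And>v. v \<in> verts (ZA n) \<Longrightarrow> f v = f' v"
    and iso: "tq_iso f' (map_prod f' f') (ZA n) (ZA n)"
  shows "ZA_quotient n f = ZA_quotient n f'"
proof -
  have "orbit_rel (verts (ZA n)) f = orbit_rel (verts (ZA n)) f'"
    using assms by (intro orbit_rel_cong) (auto simp: tq_iso_def bij_betw_apply)
  moreover have "orbit_rel (arcs (ZA n)) (map_prod f f) = orbit_rel (arcs (ZA n)) (map_prod f' f')"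
  proof (rule orbit_rel_cong)
    fix a assume a: "a \<in> arcs (ZA n)"
    then show "map_prod f' f' a \<in> arcs (ZA n)" using iso unfolding tq_iso_def by (metis bij_betwE)
    have "fst a \<in> verts (ZA n)" "snd a \<in> verts (ZA n)" using a by (auto simp: ZA_def)
    then show "map_prod f f a = map_prod f' f' a" by (cases a) (simp add: eq)
  qed
  ultimately show ?thesis by (simp add: ZA_quotient_def tq_quotient_def)
qed

lemma ZA_tau_inv_pow: "ZA_tau_inv ^^ p = ZA_shift (int p)"
  by (induction p) (auto simp: ZA_tau_inv_def ZA_shift_def fun_eq_iff)

lemma ZA_tau_Sigma: "(ZA_tau_inv ^^ p) \<circ> ZA_Sigma n = ZA_glide n (int p)"
  by (auto simp: ZA_tau_inv_pow ZA_shift_def ZA_Sigma_def ZA_glide_def fun_eq_iff)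

text \<open>Two applications of \<open>ZA_Sigma n\<close> restore the row and move the column by
  \<open>k + (n + 1 - k) = n + 1\<close>.\<close>

lemma ZA_quotient_tau_Sigma_sq:
  "ZA_quotient n ((ZA_tau_inv ^^ p) \<circ> (ZA_Sigma n ^^ 2)) = ZA_quotient n (ZA_shift (int p + int n + 1))"
proof (rule ZA_quotient_cong)
  fix v assume "v \<in> verts (ZA n)"
  then obtain a k where "v = (a, k)" "1 \<le> k" "k \<le> n" by (auto simp: ZA_def)
  then show "((ZA_tau_inv ^^ p) \<circ> (ZA_Sigma n ^^ 2)) v = ZA_shift (int p + int n + 1) v"
    by (simp add: ZA_tau_inv_pow ZA_shift_def ZA_Sigma_def numeral_2_eq_2 of_nat_diff)
qed (rule tq_iso_ZA_shift)

lemma ZA_shift_pow: "(ZA_shift q ^^ s) (a, k) = (a + int s * q, k)"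
  by (induction s) (auto simp: ZA_shift_def algebra_simps)

lemma ZA_shift_orbit:
  "(\<exists>s. (ZA_shift q ^^ s) (a, k) = (a', k') \<or> (ZA_shift q ^^ s) (a', k') = (a, k)) \<longleftrightarrow>
    k = k' \<and> q dvd a - a'"
proof
  assume "\<exists>s. (ZA_shift q ^^ s) (a, k) = (a', k') \<or> (ZA_shift q ^^ s) (a', k') = (a, k)"
  then obtain s where "k = k'" "a + int s * q = a' \<or> a' + int s * q = a"
    by (auto simp: ZA_shift_pow)
  moreover from this(2) have "a - a' = (- int s) * q \<or> a - a' = int s * q" by auto
  ultimately show "k = k' \<and> q dvd a - a'" by (metis dvd_triv_right)
next
  assume asm: "k = k' \<and> q dvd a - a'"
  then obtain t where t: "a - a' = q * t" by blast
  show "\<exists>s. (ZA_shift q ^^ s) (a, k) = (a', k') \<or> (ZA_shift q ^^ s) (a', k') = (a, k)"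
    using asm t by (intro exI[of _ "nat \<bar>t\<bar>"]) (auto simp: ZA_shift_pow abs_if algebra_simps)
qed

lemma ZA_glide_pow:
  assumes "k \<le> n + 1"
  shows "(ZA_glide n q ^^ (2 * s)) (a, k) = (a + int s * (2 * q + int n + 1), k)"
    and "(ZA_glide n q ^^ (2 * s + 1)) (a, k) =
      (a + int s * (2 * q + int n + 1) + q + int k, n + 1 - k)"
proof -
  show 1: "(ZA_glide n q ^^ (2 * s)) (a, k) = (a + int s * (2 * q + int n + 1), k)"
    using assms by (induction s) (auto simp: ZA_glide_def algebra_simps of_nat_diff)
  show "(ZA_glide n q ^^ (2 * s + 1)) (a, k) =
      (a + int s * (2 * q + int n + 1) + q + int k, n + 1 - k)"
    using 1 by (simp add: ZA_glide_def)
qed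

text \<open>Even powers of the glide are shifts by multiples of \<open>2 * q + n + 1\<close>; odd
  powers add one reflection to such a shift.\<close>

lemma ZA_glide_orbit:
  assumes "k \<le> n + 1" "k' \<le> n + 1"
  shows "(\<exists>s. (ZA_glide n q ^^ s) (a, k) = (a', k') \<or> (ZA_glide n q ^^ s) (a', k') = (a, k)) \<longleftrightarrow>
    (k = k' \<and> 2 * q + int n + 1 dvd a - a') \<or>
    (k + k' = n + 1 \<and> 2 * q + int n + 1 dvd a - a' - int k' - q)" (is "?l \<longleftrightarrow> ?r")
proof -
  let ?L = "2 * q + int n + 1"
  note pow = ZA_glide_pow[OF assms(1)] ZA_glide_pow[OF assms(2)]
  show ?thesis
  proof
    assume ?l
    then obtain s where s: "(ZA_glide n q ^^ s) (a, k) = (a', k') \<or> (ZA_glide n q ^^ s) (a', k') = (a, k)"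
      by blast
    consider t where "s = 2 * t" | t where "s = 2 * t + 1"
      by (metis evenE oddE)
    then show ?r
    proof cases
      case 1
      then have "k = k'" "a - a' = ?L * (- int t) \<or> a - a' = ?L * int t"
        using s unfolding 1 pow by (auto simp: algebra_simps)
      then show ?thesis by (metis dvd_triv_left)
    next
      case 2
      \<comment> \<open>Reading an odd power backwards costs one further period: the offsets
        \<open>q + k\<close> and \<open>q + k'\<close> add up to \<open>?L\<close>.\<close>
      have "a - a' - int k' - q = ?L * (- int t - 1)" if "(ZA_glide n q ^^ s) (a, k) = (a', k')"
        using that assms unfolding 2 pow by (auto simp: algebra_simps of_nat_diff)
      moreover have "a - a' - int k' - q = ?L * int t" if "(ZA_glide n q ^^ s) (a', k') = (a, k)"
        using that assms unfolding 2 pow by (auto simp: algebra_simps of_nat_diff)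
      moreover have "k + k' = n + 1"
        using s assms unfolding 2 pow by auto
      ultimately show ?thesis using s by (metis dvd_triv_left)
    qed
  next
    assume ?r
    then show ?l
    proof
      assume asm: "k = k' \<and> ?L dvd a - a'"
      then obtain t where t: "a - a' = ?L * t" by blast
      show ?l using asm t
        by (intro exI[of _ "2 * nat \<bar>t\<bar>"]) (simp only: pow, auto simp: abs_if algebra_simps)
    next
      assume asm: "k + k' = n + 1 \<and> ?L dvd a - a' - int k' - q"
      then obtain t where t: "a - a' - int k' - q = ?L * t" by blast
      show ?l
      proof (cases "0 \<le> t")
        case True
        then have "(ZA_glide n q ^^ (2 * nat t + 1)) (a', k') = (a, k)"
          using asm t by (simp only: pow) (auto simp: algebra_simps)
        then show ?thesis by blast
      next
        case False
        have "int k = int n + 1 - int k'" using asm by linarith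
        \<comment> \<open>For negative \<open>t\<close> the other point is moved; the exponent
          reverses the extra period found above, and \<open>t = -1\<close> gives the first
          power.\<close>
        then have "(ZA_glide n q ^^ (2 * nat (- t - 1) + 1)) (a, k) = (a', k')"
          using False asm t by (simp only: pow) (auto simp: algebra_simps)
        then show ?thesis by blast
      qed
    qed
  qed
qed

section \<open>Full subquivers in terms of end point pairs\<close>

lemma verts_full_sub: "verts (tq_full_sub Q V) = verts Q \<inter> V"
  by (simp add: tq_full_sub_def)

lemma ends_full_sub: "tq_ends (tq_full_sub Q V) = tq_ends Q"
  by (simp add: tq_full_sub_def tq_ends_def fun_eq_iff)

lemma transl_full_sub: "transl (tq_full_sub Q V) = transl Q"
  by (simp add: tq_full_sub_def)

lemma ends_arcs_full_sub:
  "tq_ends Q ` arcs (tq_full_sub Q V) =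
    tq_ends Q ` arcs Q \<inter> (verts Q \<inter> V) \<times> (verts Q \<inter> V)"
  by (auto simp: tq_full_sub_def tq_ends_def)

lemma tq_link_eq: "tq_link Q = tq_ends Q ` arcs Q \<union> {(x, transl Q x) | x. x \<in> verts Q}"
  by (auto simp: tq_link_def tq_ends_def)

section \<open>The connected components of the power\<close>

lemma ends_ZA: "tq_ends (ZA n) ` E = E"
  by (simp add: tq_ends_def ZA_def)

text \<open>Replaces the real bound on \<open>r\<close> in \<open>m_diagonals\<close> by an integer
  one, so that the cases \<open>r\<close> and \<open>n - r\<close> can be compared.\<close>

lemma ceiling_half_pred: "\<lceil>(real n - 1) / 2\<rceil> = int n div 2"
proof -
  consider k where "n = 2 * k" | k where "n = 2 * k + 1" by (metis evenE oddE)
  then show ?thesis by cases (auto intro!: ceiling_unique)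
qed

text \<open>\<open>h\<close> is half of \<open>m\<close>; its parity decides between one component
  and two in the self-dual class.\<close>

locale even_power =
  fixes n m h N :: nat
  assumes n: "1 \<le> n" and h: "1 \<le> h" and m: "m = 2 * h" and N: "N = n * m + 2"
begin

definition Q :: "(int set, (int set \<times> int set) list) tquiver" where
  "Q = tq_power m (Gamma_A N)"

text \<open>
  The diagonals of the component through \<open>(i0, c)\<close>. The range condition makes \<open>V i0 1\<close> have only
  \<open>n - 1\<close> rows.
\<close>

definition V :: "int \<Rightarrow> int \<Rightarrow> int set set" where
  "V i0 c = {chord N (i0 + int m * a) (c + int m * r) | a r.
     2 \<le> c + int m * r \<and> c + int m * r \<le> int N - 2}"

text \<open>The number of columns after which a row closes up: \<open>L * m\<close> is the multiple \<open>h * N\<close> of \<open>N\<close>.\<close>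

definition L :: int where "L = int n * int h + 1"

lemma N_ge: "2 \<le> N" and m_pos: "1 \<le> m" and L_pos: "0 < L"
  using N m h by (auto simp: L_def)

lemma int_m: "int m = 2 * int h" and int_N: "int N = int n * int m + 2" and N_L: "int N = 2 * L"
  using N m by (auto simp: L_def)

lemma V_I: "2 \<le> c + int m * r \<Longrightarrow> c + int m * r \<le> int N - 2 \<Longrightarrow>
    chord N (i0 + int m * a) (c + int m * r) \<in> V i0 c"
  by (auto simp: V_def)

lemma V_I':
  assumes "i = i0 + int m * a" "d = c + int m * r" "2 \<le> d" "d \<le> int N - 2"
  shows "chord N i d \<in> V i0 c"
  using V_I assms by blast

lemma V_E:
  assumes "x \<in> V i0 c"
  obtains a r where "x = chord N (i0 + int m * a) (c + int m * r)"
    "2 \<le> c + int m * r" "c + int m * r \<le> int N - 2"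
  using assms unfolding V_def by blast

lemma verts_Q: "verts Q = diagonals N"
  and ends_Q: "tq_ends Q ` arcs Q = steps N (int m)"
  and inj_ends_Q: "inj_on (tq_ends Q) (arcs Q)"
  and transl_Q: "transl Q (chord N i d) = chord N (i - int m) d"
  unfolding Q_def using N_ge m_pos
  by (simp_all add: verts_Gamma_power ends_Gamma_power inj_ends_Gamma_power transl_Gamma_power)

lemma V_subset: "V i0 c \<subseteq> diagonals N"
  using N_ge by (auto simp: V_def diagonals_eq)

lemma link_Q: "tq_link Q = steps N (int m) \<union> {(x, transl Q x) | x. x \<in> diagonals N}"
  by (simp add: tq_link_eq ends_Q verts_Q)

section \<open>The sets \<open>V\<close> are closed under links and connected\<close>

lemma V_steps:
  assumes "x \<in> V i0 c" "(x, y) \<in> steps N (int m)"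
  shows "y \<in> V i0 c"
proof -
  obtain a r where x: "x = chord N (i0 + int m * a) (c + int m * r)"
    and r: "2 \<le> c + int m * r" "c + int m * r \<le> int N - 2"
    using assms(1) by (rule V_E)
  from steps_from[OF assms(2)[unfolded x] _ r] consider
    "y = chord N (i0 + int m * a) (c + int m * r + int m)" "c + int m * r + int m \<le> int N - 2"
    | "y = chord N (i0 + int m * a + int m) (c + int m * r - int m)" "2 \<le> c + int m * r - int m"
    by auto
  then show ?thesis
  proof cases
    case 1
    then show ?thesis using r unfolding 1(1)
      by (intro V_I'[of _ _ a _ _ "r + 1"]) (auto simp: algebra_simps)
  next
    case 2
    then show ?thesis using r unfolding 2(1)
      by (intro V_I'[of _ _ "a + 1" _ _ "r - 1"]) (auto simp: algebra_simps)
  qed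
qed

lemma V_steps_back:
  assumes "y \<in> V i0 c" "(x, y) \<in> steps N (int m)"
  shows "x \<in> V i0 c"
proof -
  obtain a r where y: "y = chord N (i0 + int m * a) (c + int m * r)"
    and r: "2 \<le> c + int m * r" "c + int m * r \<le> int N - 2"
    using assms(1) by (rule V_E)
  from steps_to[OF assms(2)[unfolded y] _ r] consider
    "x = chord N (i0 + int m * a) (c + int m * r - int m)" "2 \<le> c + int m * r - int m"
    | "x = chord N (i0 + int m * a - int m) (c + int m * r + int m)" "c + int m * r + int m \<le> int N - 2"
    by auto
  then show ?thesis
  proof cases
    case 1
    then show ?thesis using r unfolding 1(1)
      by (intro V_I'[of _ _ a _ _ "r - 1"]) (auto simp: algebra_simps)
  next
    case 2
    then show ?thesis using r unfolding 2(1)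
      by (intro V_I'[of _ _ "a - 1" _ _ "r + 1"]) (auto simp: algebra_simps)
  qed
qed

lemma V_transl:
  assumes "x \<in> V i0 c"
  shows "transl Q x \<in> V i0 c"
proof -
  obtain a r where x: "x = chord N (i0 + int m * a) (c + int m * r)"
    and r: "2 \<le> c + int m * r" "c + int m * r \<le> int N - 2"
    using assms by (rule V_E)
  then have "transl Q x = chord N (i0 + int m * (a - 1)) (c + int m * r)"
    by (simp add: transl_Q algebra_simps)
  then show ?thesis using V_I[OF r] by simp
qed

lemma V_transl_back:
  assumes "transl Q x \<in> V i0 c" "x \<in> diagonals N"
  shows "x \<in> V i0 c"
proof -
  obtain i d where x: "x = chord N i d" using assms(2) N_ge by (auto simp: diagonals_eq)
  obtain a r where "chord N (i - int m) d = chord N (i0 + int m * a) (c + int m * r)"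
    and r: "2 \<le> c + int m * r" "c + int m * r \<le> int N - 2"
    using assms(1) unfolding x transl_Q by (rule V_E)
  \<comment> \<open>Rotating by \<open>m\<close> undoes the translation and raises the column index
    \<open>a\<close> by one.\<close>
  from this(1)[THEN arg_cong, of "rotate_dgl N (int m)"]
  have "x = chord N (i0 + int m * a + int m) (c + int m * r)" by (simp add: rotate_chord x)
  then show ?thesis using r by (auto intro!: V_I'[of _ _ "a + 1"] simp: algebra_simps)
qed

lemma V_link:
  assumes "(x, y) \<in> tq_link Q"
  shows "x \<in> V i0 c \<longleftrightarrow> y \<in> V i0 c"
proof -
  from assms consider "(x, y) \<in> steps N (int m)" | "x \<in> diagonals N" "y = transl Q x"
    unfolding link_Q by blast
  then show ?thesis using V_steps V_steps_back V_transl V_transl_back by cases metis+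
qed

lemma V_closed:
  assumes "(x, y) \<in> (tq_link Q \<union> (tq_link Q)\<inverse>)\<^sup>*" "x \<in> V i0 c"
  shows "y \<in> V i0 c"
  using assms
proof (induction rule: rtrancl_induct)
  case (step y z)
  then have "y \<in> V i0 c \<longleftrightarrow> z \<in> V i0 c" using V_link[of y z] V_link[of z y] by blast
  then show ?case using step by blast
qed

text \<open>The translation slides every diagonal along its row to column 0, and arrows climb from
  row to row there. The lengths increase with the row, so all rows between two admissible ones are
  admissible.\<close>

lemma V_connected:
  assumes "x \<in> V i0 c" "y \<in> V i0 c"
  shows "(x, y) \<in> (tq_link Q \<union> (tq_link Q)\<inverse>)\<^sup>*"
proof -
  let ?R = "(tq_link Q \<union> (tq_link Q)\<inverse>)\<^sup>*"
  let ?G = "\<lambda>a r. chord N (i0 + int m * a) (c + int m * r)"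
  let ?ok = "\<lambda>r. 2 \<le> c + int m * r \<and> c + int m * r \<le> int N - 2"
  have sym: "(u, v) \<in> ?R \<Longrightarrow> (v, u) \<in> ?R" for u v
    by (rule symD[OF sym_rtrancl[OF sym_Un_converse]])
  have row1: "(?G (a + 1) r, ?G a r) \<in> ?R" if "?ok r" for a r
  proof -
    have "?G (a + 1) r \<in> diagonals N" using V_I[of c r] that V_subset by blast
    moreover have "transl Q (?G (a + 1) r) = ?G a r" by (simp add: transl_Q algebra_simps)
    ultimately have "(?G (a + 1) r, ?G a r) \<in> tq_link Q" unfolding link_Q by blast
    then show ?thesis by blast
  qed
  have row: "(?G a r, ?G 0 r) \<in> ?R" if "?ok r" for a r
  proof (induction a rule: int_induct[where k = 0])
    case (step1 i)
    then show ?case using row1[OF that, of i] by (meson rtrancl_trans)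
  next
    case (step2 i)
    then show ?case using sym[OF row1[OF that, of "i - 1"]] by (auto intro: rtrancl_trans)
  qed simp
  have col1: "(?G 0 r, ?G 0 (r + 1)) \<in> ?R" if "?ok r" "?ok (r + 1)" for r
  proof -
    have "(?G 0 r, chord N (i0 + int m * 0) (c + int m * r + int m)) \<in> steps N (int m)"
      using that by (intro steps_up) (auto simp: algebra_simps)
    then have "(?G 0 r, ?G 0 (r + 1)) \<in> steps N (int m)" by (simp add: algebra_simps)
    then show ?thesis unfolding link_Q by blast
  qed
  have col: "r \<le> r' \<Longrightarrow> ?ok r \<Longrightarrow> ?ok r' \<Longrightarrow> (?G 0 r, ?G 0 r') \<in> ?R" for r r'
  proof (induction r' rule: int_ge_induct)
    case (step i)
    have "c + int m * i \<le> c + int m * (i + 1)" "c + int m * r \<le> c + int m * i"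
      using step.hyps m_pos by simp_all
    then have ok: "?ok i" using step.prems by linarith
    then show ?case using step col1[OF ok step.prems(2)] by (meson rtrancl_trans)
  qed simp
  obtain a r where x: "x = ?G a r" "?ok r" using assms(1) by (rule V_E) blast
  obtain b s where y: "y = ?G b s" "?ok s" using assms(2) by (rule V_E) blast
  have "(?G 0 r, ?G 0 s) \<in> ?R"
    using col[of r s] col[of s r] sym x(2) y(2) by (cases "r \<le> s") auto
  then show ?thesis
    using row[OF x(2), of a] sym[OF row[OF y(2), of b]] unfolding x(1) y(1)
    by (meson rtrancl_trans)
qed

lemma component_eq:
  assumes "x \<in> V i0 c"
  shows "tq_component Q x = tq_full_sub Q (V i0 c)"
proof -
  have "{y. (x, y) \<in> (tq_link Q \<union> (tq_link Q)\<inverse>)\<^sup>*} = V i0 c"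
    using V_closed[OF _ assms] V_connected[OF assms] by blast
  then show ?thesis by (simp add: tq_component_def)
qed

lemma verts_full_sub_V: "verts (tq_full_sub Q (V i0 c)) = V i0 c"
  using V_subset by (auto simp: verts_full_sub verts_Q)

section \<open>Congruence criteria for membership in \<open>V\<close>\<close>

lemma chord_mem_V:
  assumes "int m dvd d - c" "even (i - i0)" "2 \<le> d" "d \<le> int N - 2"
  shows "chord N i d \<in> V i0 c"
proof -
  obtain j where j: "i - i0 = 2 * j" using assms(2) by blast
  obtain r where r: "d - c = int m * r" using assms(1) by blast
  \<comment> \<open>Going \<open>j\<close> times round the polygon changes \<open>i\<close> by
    \<open>j * N = 2 * j + n * m * j\<close>. So modulo \<open>m\<close> steps of 2 come for free,
    and only the parity of \<open>i\<close> matters.\<close>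
  have "i - (i0 + int m * (- int n * j)) = int N * j"
    using j by (simp add: int_N algebra_simps)
  then have "chord N i d = chord N (i0 + int m * (- int n * j)) (c + int m * r)"
    using r by (subst chord_shift[of N i "i0 + int m * (- int n * j)"]) (auto simp: algebra_simps)
  also have "\<dots> \<in> V i0 c" using r assms by (intro V_I) auto
  finally show ?thesis .
qed

text \<open>Apply \<open>chord_mem_V\<close> to the flipped chord: its length \<open>N - d\<close>
  is congruent to \<open>2 - d\<close> modulo \<open>m\<close>.\<close>

lemma chord_mem_V_flip:
  assumes "int m dvd d + c - 2" "even (i + d - i0)" "2 \<le> d" "d \<le> int N - 2"
  shows "chord N i d \<in> V i0 c"
proof -
  have "int N - d - c = int n * int m - (d + c - 2)" by (simp add: int_N)
  moreover have "int m dvd int n * int m - (d + c - 2)" by (rule dvd_diff[OF dvd_triv_right assms(1)])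
  ultimately have "int m dvd int N - d - c" by (simp only:)
  then have "chord N (i + d) (int N - d) \<in> V i0 c"
    using assms(2) by (rule chord_mem_V) (use assms in simp_all)
  then show ?thesis by (simp add: chord_flip)
qed

text \<open>A class \<open>c\<close> that is odd and fixed by the flip meets both parities of \<open>i\<close>.\<close>

lemma odd_self_dual_V:
  assumes "int m dvd 2 * c - 2" "odd c" "int m dvd d - c" "2 \<le> d" "d \<le> int N - 2"
  shows "chord N i d \<in> V 1 c"
proof (cases "odd i")
  case True
  then show ?thesis using assms by (intro chord_mem_V) auto
next
  case False
  have "int m dvd (d - c) + (2 * c - 2)" using assms by (intro dvd_add) auto
  then have "int m dvd d + c - 2" by (simp add: algebra_simps)
  moreover have "odd d"
  proof -
    have "even (d - c)" using dvd_trans[OF _ assms(3), of 2] by (simp add: int_m)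
    then show ?thesis using assms(2) by auto
  qed
  ultimately show ?thesis using False assms by (intro chord_mem_V_flip) auto
qed

text \<open>The invariants that keep the components apart. As \<open>N\<close> and \<open>m\<close>
  are both even, the parity of \<open>i\<close> survives reduction modulo \<open>N\<close> and moves
  along the row; a flip adds the parity of the length.\<close>

lemma chord_mem_V_imp:
  assumes "chord N i c \<in> V i' c'" "2 \<le> c" "c \<le> int N - 2"
  shows "int m dvd c - c' \<and> even (i - i') \<or> int m dvd c + c' - 2 \<and> even (i - i' - c)"
proof -
  obtain a r where eq: "chord N i c = chord N (i' + int m * a) (c' + int m * r)"
    and r: "2 \<le> c' + int m * r" "c' + int m * r \<le> int N - 2"
    using assms(1) by (rule V_E)
  have 2: "even (int N)" "even (int m)" by (simp_all add: N_L int_m)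
  consider "int N dvd i - (i' + int m * a)" "c = c' + int m * r"
    | "int N dvd i - (i' + int m * a) - (c' + int m * r)" "c = int N - (c' + int m * r)"
    using eq assms r by (subst (asm) chord_eq_iff) auto
  then show ?thesis
  proof cases
    case 1
    from 2(1) 1(1) have "even (i - (i' + int m * a))" by (rule dvd_trans)
    then show ?thesis using 1(2) 2(2) by auto
  next
    case 2
    note par = \<open>even (int N)\<close> \<open>even (int m)\<close>
    from par(1) 2(1) have "even (i - (i' + int m * a) - (c' + int m * r))" by (rule dvd_trans)
    moreover have "even (c + (c' + int m * r))" using 2(2) par by simp
    ultimately have "even (i - i' - c)" using par(2) by auto
    moreover have "c + c' - 2 = int m * (int n - r)" using 2(2) by (simp add: int_N algebra_simps)
    ultimately show ?thesis by simp
  qed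
qed

text \<open>From \<open>2 \<le> c \<le> m\<close> the lengths in rows 1 to \<open>n\<close> start at
  \<open>c\<close> and stay below \<open>n * m = N - 2\<close>. With \<open>row_range_conv\<close>
  this shows that the class of \<open>c\<close> has exactly \<open>n\<close> rows.\<close>

lemma row_range:
  assumes "2 \<le> c" "c \<le> int h + 1" "1 \<le> k" "k \<le> int n"
  shows "2 \<le> c + int m * (k - 1)" "c + int m * (k - 1) \<le> int N - 2"
proof -
  have "0 \<le> int m * (k - 1)" using assms by simp
  then show "2 \<le> c + int m * (k - 1)" using assms(1) by linarith
  have "int m * k \<le> int m * int n" using assms by (intro mult_left_mono) auto
  moreover have "c \<le> int m" using assms h int_m by linarith
  moreover have "c + int m * (k - 1) = int m * k + (c - int m)" by (simp add: algebra_simps)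
  moreover have "int N - 2 = int m * int n" by (simp add: int_N)
  ultimately show "c + int m * (k - 1) \<le> int N - 2" by linarith
qed

lemma row_range_conv:
  assumes "2 \<le> c" "c \<le> int h + 1" "2 \<le> c + int m * r" "c + int m * r \<le> int N - 2"
  shows "0 \<le> r" "r + 1 \<le> int n"
proof -
  show "0 \<le> r"
  proof (rule ccontr)
    assume "\<not> 0 \<le> r"
    then have "int m * r \<le> int m * (- 1)" by (intro mult_left_mono) auto
    then have "int m * r \<le> - int m" by simp
    then show False using assms h int_m by linarith
  qed
  show "r + 1 \<le> int n"
  proof (rule ccontr)
    assume "\<not> r + 1 \<le> int n"
    then have "int m * int n \<le> int m * r" by (intro mult_left_mono) auto
    moreover have "int N - 2 = int m * int n" by (simp add: int_N)
    ultimately show False using assms by linarith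
  qed
qed

lemma chord_self_mem_V:
  assumes "2 \<le> c" "c \<le> int h + 1"
  shows "chord N i c \<in> V i c"
  using row_range[OF assms, of 1] n by (intro V_I'[of _ _ 0 _ _ 0]) auto

section \<open>The list of components, its completeness and the absence of repetitions\<close>

definition part :: "int \<times> int \<Rightarrow> (int set, (int set \<times> int set) list) tquiver" where
  "part = (\<lambda>(i, c). tq_full_sub Q (V i c))"

text \<open>The first entry represents a parity of the starting vertex, the second a class of
  lengths up to the flip \<open>c \<mapsto> m + 2 - c\<close>. The self-dual class
  \<open>h + 1\<close> needs one parity if \<open>h\<close> is even and both if \<open>h\<close> is
  odd; the class 1 of the \<open>m\<close>-diagonals is kept apart.\<close>

definition J :: "(int \<times> int) set" where
  "J = {1, 2} \<times> {2..int h} \<union> (if even h then {(1, int h + 1)} else {(1, int h + 1), (2, int h + 1)})"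

lemma J_cases:
  assumes "(i, c) \<in> J"
  shows "i = 1 \<or> i = 2" "2 \<le> c" "c \<le> int h + 1" "c = int h + 1 \<Longrightarrow> even h \<Longrightarrow> i = 1"
  using assms h by (auto simp: J_def split: if_splits)

lemma J_I: "i = 1 \<or> i = 2 \<Longrightarrow> 2 \<le> c \<Longrightarrow> c \<le> int h \<Longrightarrow> (i, c) \<in> J"
  by (auto simp: J_def)

lemma diagonal_in_some_V:
  assumes "x \<in> diagonals N"
  shows "x \<in> V 1 1 \<or> (\<exists>(i, c) \<in> J. x \<in> V i c)"
proof -
  obtain i d where x: "x = chord N i d" and d: "2 \<le> d" "d \<le> int N - 2"
    using assms N_ge by (auto simp: diagonals_eq)
  \<comment> \<open>The representative of \<open>d\<close> modulo \<open>m\<close> in the range from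
    1 to \<open>m\<close>, rather than from 0.\<close>
  define c where "c = (d - 1) mod int m + 1"
  have mp: "0 < int m" using m_pos by simp
  have c: "1 \<le> c" "c \<le> int m"
    using pos_mod_sign[OF mp, of "d - 1"] pos_mod_bound[OF mp, of "d - 1"] unfolding c_def by linarith+
  have "d - c = int m * ((d - 1) div int m)"
    unfolding c_def using div_mult_mod_eq[of "d - 1" "int m"] by (simp add: algebra_simps)
  then have dc: "int m dvd d - c" by simp
  \<comment> \<open>\<open>p\<close> chooses the starting vertex 1 or 2 of the right parity.\<close>
  obtain p :: "int \<Rightarrow> int" where p: "\<And>j. (p j = 1 \<or> p j = 2) \<and> even (j - p j)"
  proof
    fix j :: int
    show "((if odd j then 1 else 2) = (1 :: int) \<or> (if odd j then 1 else 2) = (2 :: int)) \<and>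
      even (j - (if odd j then 1 else 2))" by auto
  qed
  consider "c = 1" | "2 \<le> c" "c \<le> int h" | "c = int h + 1" "even h" | "c = int h + 1" "odd h"
    | "int h + 2 \<le> c" using c by linarith
  then show ?thesis
  proof cases
    case 1
    then show ?thesis using odd_self_dual_V[of 1 d i] dc d x by auto
  next
    case 2
    then have "(p i, c) \<in> J" using p by (intro J_I) auto
    moreover have "x \<in> V (p i) c" unfolding x using dc d p by (intro chord_mem_V) auto
    ultimately show ?thesis by blast
  next
    case 3
    then have "(1, c) \<in> J" by (simp add: J_def)
    moreover have "x \<in> V 1 c" unfolding x
      using 3 dc d by (intro odd_self_dual_V) (auto simp: int_m)
    ultimately show ?thesis by blast
  next
    case 4
    then have "(p i, c) \<in> J" using p[of i] by (auto simp: J_def)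
    moreover have "x \<in> V (p i) c" unfolding x using dc d p by (intro chord_mem_V) auto
    ultimately show ?thesis by blast
  next
    case 5
    \<comment> \<open>Classes above \<open>h + 1\<close> are flipped below it; the flipped chord
      starts at \<open>i + d\<close>, whose parity therefore counts.\<close>
    have "(p (i + d), int m + 2 - c) \<in> J"
      using 5 c p by (intro J_I) (auto simp: int_m)
    moreover have "int m dvd d + (int m + 2 - c) - 2"
    proof -
      have "d + (int m + 2 - c) - 2 = (d - c) + int m" by simp
      then show ?thesis using dc by (metis dvd_add dvd_refl)
    qed
    then have "x \<in> V (p (i + d)) (int m + 2 - c)" unfolding x
      using d p by (intro chord_mem_V_flip) auto
    ultimately show ?thesis by blast
  qed
qed

lemma J_range:
  assumes "(i, c) \<in> J"
  shows "2 \<le> c" "c \<le> int N - 2"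
  using J_cases(2,3)[OF assms] row_range[of c 1] n by auto

lemma V_J_not_m: assumes "(i, c) \<in> J" shows "V i c \<noteq> V 1 1"
proof
  assume "V i c = V 1 1"
  then have "chord N i c \<in> V 1 1" using chord_self_mem_V J_cases[OF assms] by blast
  \<comment> \<open>Class 1 is fixed by the flip, so both alternatives of
    \<open>chord_mem_V_imp\<close> yield the same divisibility.\<close>
  then have "int m dvd c - 1"
    using chord_mem_V_imp[of i c 1 1] J_range[OF assms] by auto
  moreover have "\<bar>c - 1\<bar> < int m" using J_cases[OF assms] h by (auto simp: int_m)
  ultimately show False using dvd_small_eq_0 J_range[OF assms] by force
qed

text \<open>Without a flip, the class and the parity agree directly. With a flip,
  \<open>c + c' = m + 2\<close> forces both classes to be \<open>h + 1\<close>: for even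
  \<open>h\<close> only the starting vertex 1 is listed, and for odd \<open>h\<close> the length
  \<open>h + 1\<close> is even, so the flip preserves the parity.\<close>

lemma inj_V_J:
  assumes J: "(i, c) \<in> J" "(i', c') \<in> J" and eq: "V i c = V i' c'"
  shows "(i, c) = (i', c')"
proof -
  have "chord N i c \<in> V i' c'" using eq chord_self_mem_V J_cases[OF J(1)] by blast
  then consider "int m dvd c - c'" "even (i - i')" | "int m dvd c + c' - 2" "even (i - i' - c)"
    using chord_mem_V_imp J_range[OF J(1)] by blast
  then show ?thesis
  proof cases
    case 1
    have "\<bar>c - c'\<bar> < int m" using J_cases[OF J(1)] J_cases[OF J(2)] h by (auto simp: int_m)
    then have "c = c'" using dvd_small_eq_0[OF 1(1)] by simp
    then show ?thesis using 1(2) J_cases(1)[OF J(1)] J_cases(1)[OF J(2)] by auto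
  next
    case 2
    \<comment> \<open>Subtracting \<open>m\<close> brings the multiple of \<open>m\<close> into the
      open interval from \<open>-m\<close> to \<open>m\<close>, where it must vanish.\<close>
    have "int m dvd c + c' - 2 - int m" using 2(1) by simp
    moreover have "\<bar>c + c' - 2 - int m\<bar> < int m"
      using J_cases(2,3)[OF J(1)] J_cases(2,3)[OF J(2)] by (auto simp: int_m)
    ultimately have "c + c' = int m + 2" using dvd_small_eq_0[of "int m" "c + c' - 2 - int m"] by linarith
    then have c: "c = int h + 1" "c' = int h + 1"
      using J_cases(3)[OF J(1)] J_cases(3)[OF J(2)] by (auto simp: int_m)
    show ?thesis
    proof (cases "even h")
      case True
      then show ?thesis using c J_cases(4)[OF J(1)] J_cases(4)[OF J(2)] by simp
    next
      case False
      then have "even (i - i')" using 2(2) c by auto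
      then show ?thesis using c J_cases(1)[OF J(1)] J_cases(1)[OF J(2)] by auto
    qed
  qed
qed

lemma inj_part: "inj_on part J"
proof (rule inj_onI)
  fix p q assume "p \<in> J" "q \<in> J" "part p = part q"
  moreover obtain i c i' c' where "p = (i, c)" "q = (i', c')" by (cases p, cases q)
  ultimately show "p = q" using inj_V_J verts_full_sub_V by (metis part_def case_prod_conv)
qed

lemma part_not_m: "tq_full_sub Q (V 1 1) \<notin> part ` J"
proof
  assume "tq_full_sub Q (V 1 1) \<in> part ` J"
  then obtain i c where "(i, c) \<in> J" "tq_full_sub Q (V 1 1) = tq_full_sub Q (V i c)"
    by (auto simp: part_def)
  then show False using V_J_not_m verts_full_sub_V by metis
qed

text \<open>A row of class 1 has length \<open>1 + m * r\<close> with
  \<open>0 < m * r < n * m\<close>. For \<open>n = 1\<close> no such \<open>r\<close> exists; for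
  larger \<open>n\<close>, \<open>r = 1\<close> works.\<close>

lemma V_1_1_empty_iff: "V 1 1 = {} \<longleftrightarrow> n = 1"
proof
  assume "V 1 1 = {}"
  show "n = 1"
  proof (rule ccontr)
    assume "n \<noteq> 1"
    then have "2 \<le> n" using n by simp
    then have "int m * 2 \<le> int m * int n" by (intro mult_left_mono) auto
    moreover have "int N - 2 = int m * int n" by (simp add: int_N)
    ultimately have "1 + int m * 1 \<le> int N - 2" using m_pos by linarith
    then have "chord N 1 (1 + int m * 1) \<in> V 1 1"
      using m_pos by (intro V_I'[of _ _ 0 _ _ 1]) auto
    then show False using \<open>V 1 1 = {}\<close> by simp
  qed
next
  assume n1: "n = 1"
  have False if "2 \<le> 1 + int m * r" "1 + int m * r \<le> int N - 2" for r
  proof -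
    have "int N = int m + 2" using n1 by (simp add: int_N)
    then have r: "0 < int m * r" "int m * r < int m" using that by linarith+
    have "int m * r \<le> int m * 0" if "r \<le> 0" using that by (intro mult_left_mono) auto
    moreover have "int m * 1 \<le> int m * r" if "1 \<le> r" using that by (intro mult_left_mono) auto
    ultimately show False using r by linarith
  qed
  then show "V 1 1 = {}" unfolding V_def by blast
qed

lemma components_Q:
  "tq_components Q = (if n = 1 then {} else {tq_full_sub Q (V 1 1)}) \<union> part ` J"
proof -
  have 1: "tq_component Q x \<in> (if n = 1 then {} else {tq_full_sub Q (V 1 1)}) \<union> part ` J"
    if "x \<in> diagonals N" for x
  proof -
    from diagonal_in_some_V[OF that] consider "x \<in> V 1 1" | i c where "(i, c) \<in> J" "x \<in> V i c" by auto
    then show ?thesis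
    proof cases
      case 1
      then show ?thesis using component_eq V_1_1_empty_iff by auto
    next
      case 2
      then have "tq_component Q x = part (i, c)" using component_eq by (simp add: part_def)
      then show ?thesis using 2(1) by blast
    qed
  qed
  have 2: "part p \<in> tq_components Q" if "p \<in> J" for p
  proof -
    obtain i c where p: "p = (i, c)" by (cases p)
    have "chord N i c \<in> V i c" using that p J_cases chord_self_mem_V by blast
    then show ?thesis using component_eq V_subset unfolding tq_components_def verts_Q p part_def
      by (metis (no_types, lifting) case_prod_conv image_iff subsetD)
  qed
  have 3: "tq_full_sub Q (V 1 1) \<in> tq_components Q" if n1: "n \<noteq> 1"
  proof -
    obtain x where "x \<in> V 1 1" using n1 V_1_1_empty_iff by blast
    then show ?thesis using component_eq V_subset unfolding tq_components_def verts_Q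
      by (metis (no_types, lifting) image_iff subsetD)
  qed
  show ?thesis
  proof
    show "tq_components Q \<subseteq> (if n = 1 then {} else {tq_full_sub Q (V 1 1)}) \<union> part ` J"
      using 1 unfolding tq_components_def verts_Q by blast
    show "(if n = 1 then {} else {tq_full_sub Q (V 1 1)}) \<union> part ` J \<subseteq> tq_components Q"
      using 2 3 by (cases "n = 1") (simp_all add: image_subset_iff)
  qed
qed

lemma card_J: "card J = (if even h then m - 1 else m)"
proof -
  have "card ({1, 2::int} \<times> {2..int h}) = 2 * (h - 1)" by (simp add: card_cartesian_product)
  moreover have "card (if even h then {(1::int, int h + 1)} else {(1, int h + 1), (2, int h + 1)}) =
      (if even h then 1 else 2)" by auto
  ultimately show ?thesis unfolding J_def using h
    by (subst card_Un_disjoint) (auto simp: m)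
qed

lemma card_components_Q:
  assumes "2 \<le> n"
  shows "card (tq_components Q) = (if even h then m else m + 1)"
proof -
  have "finite J" by (auto simp: J_def)
  then have "card (insert (tq_full_sub Q (V 1 1)) (part ` J)) = Suc (card J)"
    using part_not_m inj_part by (simp add: card_image)
  then show ?thesis using assms m_pos by (simp add: components_Q card_J)
qed

lemma union_Q: "tq_is_union Q (insert (tq_full_sub Q (V 1 1)) (part ` J))" (is "tq_is_union Q ?S")
proof -
  have cover: "\<exists>i c. tq_full_sub Q (V i c) \<in> ?S \<and> x \<in> V i c" if x: "x \<in> diagonals N" for x
  proof -
    from diagonal_in_some_V[OF x] consider "x \<in> V 1 1" | i c where "(i, c) \<in> J" "x \<in> V i c" by auto
    then show ?thesis
    proof cases
      case 2
      then have "tq_full_sub Q (V i c) \<in> part ` J" by (force simp: part_def)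
      then show ?thesis using 2 by blast
    qed blast
  qed
  have sub: "\<exists>W. C = tq_full_sub Q W" if "C \<in> ?S" for C
    using that by (auto simp: part_def)
  \<comment> \<open>The head of an arrow lies in the same set \<open>V\<close> as its tail, so
    covering the vertices covers the arrows.\<close>
  have "arcs Q \<subseteq> (\<Union>C\<in>?S. arcs C)"
  proof
    fix a assume a: "a \<in> arcs Q"
    then have st: "(tail Q a, head Q a) \<in> steps N (int m)"
      using ends_Q by (auto simp: tq_ends_def)
    then have dg: "tail Q a \<in> diagonals N"
      using N_ge by (auto simp: steps_def chord_mem_diagonals)
    then obtain i c where ic: "tq_full_sub Q (V i c) \<in> ?S" "tail Q a \<in> V i c" using cover by blast
    then have "head Q a \<in> V i c" using V_steps st by blast
    then have "a \<in> arcs (tq_full_sub Q (V i c))"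
      using a ic V_subset by (auto simp: tq_full_sub_def verts_Q)
    then show "a \<in> (\<Union>C\<in>?S. arcs C)" using ic by blast
  qed
  moreover have "verts Q \<subseteq> (\<Union>C\<in>?S. verts C)"
  proof
    fix x assume "x \<in> verts Q"
    then obtain i c where "tq_full_sub Q (V i c) \<in> ?S" "x \<in> V i c" using cover verts_Q by blast
    then show "x \<in> (\<Union>C\<in>?S. verts C)" using verts_full_sub_V by blast
  qed
  moreover have same: "verts C \<subseteq> verts Q \<and> arcs C \<subseteq> arcs Q \<and> tail C = tail Q \<and> head C = head Q \<and> transl C = transl Q"
    if "C \<in> ?S" for C
    using sub[OF that] by (auto simp: tq_full_sub_def)
  ultimately have "verts Q = (\<Union>C\<in>?S. verts C)" "arcs Q = (\<Union>C\<in>?S. arcs C)"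
    by (meson UN_least subset_antisym)+
  then show ?thesis using same unfolding tq_is_union_def by simp
qed


section \<open>The covering of a component by the strip quiver, row \<open>k\<close> carrying the
  length \<open>c + m * (k - 1)\<close>\<close>

definition unroll :: "int \<Rightarrow> int \<Rightarrow> int \<times> nat \<Rightarrow> int set" where
  "unroll i0 c = (\<lambda>(a, k). chord N (i0 + int m * a) (c + int m * (int k - 1)))"

lemma unroll_image:
  assumes c: "2 \<le> c" "c \<le> int h + 1"
  shows "unroll i0 c ` verts (ZA n) = V i0 c"
proof (intro equalityI subsetI)
  fix x assume "x \<in> unroll i0 c ` verts (ZA n)"
  then obtain a k where "x = unroll i0 c (a, k)" "1 \<le> k" "k \<le> n" by (auto simp: ZA_def)
  then show "x \<in> V i0 c" using row_range[OF c, of "int k"] by (auto simp: unroll_def intro!: V_I)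
next
  fix x assume "x \<in> V i0 c"
  then obtain a r where x: "x = chord N (i0 + int m * a) (c + int m * r)"
    and r: "2 \<le> c + int m * r" "c + int m * r \<le> int N - 2"
    by (rule V_E)
  then have "0 \<le> r" "r + 1 \<le> int n" using row_range_conv c by auto
  then have "(a, nat (r + 1)) \<in> verts (ZA n)" "x = unroll i0 c (a, nat (r + 1))"
    by (auto simp: ZA_def unroll_def x)
  then show "x \<in> unroll i0 c ` verts (ZA n)" by blast
qed

lemma unroll_eq_iff:
  assumes c: "2 \<le> c" "c \<le> int h + 1" and k: "1 \<le> k" "k \<le> n" "1 \<le> k'" "k' \<le> n"
  shows "unroll i0 c (a, k) = unroll i0 c (a', k') \<longleftrightarrow>
    (int N dvd int m * (a - a') \<and> k = k') \<or>
    (int N dvd int m * (a - a') - (c + int m * (int k' - 1)) \<and>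
      2 * c + int m * (int k + int k' - 2) = int N)"
proof -
  have 1: "i0 + int m * a - (i0 + int m * a') = int m * (a - a')" by (simp add: algebra_simps)
  have 2: "c + int m * (int k - 1) = c + int m * (int k' - 1) \<longleftrightarrow> k = k'"
    using m_pos by simp
  have 3: "c + int m * (int k - 1) = int N - (c + int m * (int k' - 1)) \<longleftrightarrow>
      2 * c + int m * (int k + int k' - 2) = int N"
    by (auto simp: algebra_simps)
  show ?thesis
    unfolding unroll_def prod.case using row_range[OF c, of "int k"] row_range[OF c, of "int k'"] k
    by (subst chord_eq_iff) (auto simp only: 1 2 3 intro: zero_less_one, auto)
qed

text \<open>By \<open>steps_from\<close> a lifted tail has at most two outgoing steps, and the range
  conditions on their targets say exactly that the corresponding arrow of \<open>ZA n\<close> stays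
  within the rows 1 to \<open>n\<close>.\<close>

lemma unroll_image_arcs:
  assumes c: "2 \<le> c" "c \<le> int h + 1"
  shows "map_prod (unroll i0 c) (unroll i0 c) ` arcs (ZA n) =
    steps N (int m) \<inter> V i0 c \<times> V i0 c"
proof (intro equalityI subsetI)
  fix e assume "e \<in> map_prod (unroll i0 c) (unroll i0 c) ` arcs (ZA n)"
  then obtain v w where vw: "(v, w) \<in> arcs (ZA n)" "e = (unroll i0 c v, unroll i0 c w)"
    by (elim imageE) (metis map_prod_simp prod.collapse)
  then have "v \<in> verts (ZA n)" "w \<in> verts (ZA n)" by (auto simp: ZA_def)
  then have "e \<in> V i0 c \<times> V i0 c" using vw unroll_image[OF c] by blast
  moreover from vw(1) consider a k where "v = (a, k)" "w = (a, k + 1)" "1 \<le> k" "k + 1 \<le> n"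
    | a k where "v = (a, k + 1)" "w = (a + 1, k)" "1 \<le> k" "k + 1 \<le> n"
    by (auto simp: ZA_def)
  then have "e \<in> steps N (int m)"
  proof cases
    case 1
    have "(unroll i0 c v, chord N (i0 + int m * a) (c + int m * (int k - 1) + int m)) \<in> steps N (int m)"
      unfolding 1 unroll_def prod.case
      using row_range[OF c, of "int k"] row_range[OF c, of "int k + 1"] 1
      by (intro steps_up) (auto simp: algebra_simps)
    then show ?thesis by (simp add: vw(2) 1 unroll_def algebra_simps)
  next
    case 2
    have "(unroll i0 c v, chord N (i0 + int m * a + int m) (c + int m * int k - int m)) \<in> steps N (int m)"
      unfolding 2 unroll_def prod.case
      using row_range[OF c, of "int k"] row_range[OF c, of "int k + 1"] 2
        steps_down[of "c + int m * int k" "int m" N "i0 + int m * a"]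
      by (auto simp: algebra_simps)
    then show ?thesis by (simp add: vw(2) 2 unroll_def algebra_simps)
  qed
  ultimately show "e \<in> steps N (int m) \<inter> V i0 c \<times> V i0 c" by blast
next
  fix e assume e: "e \<in> steps N (int m) \<inter> V i0 c \<times> V i0 c"
  then have "fst e \<in> unroll i0 c ` verts (ZA n)"
    unfolding unroll_image[OF c] by (simp add: mem_Times_iff)
  then obtain v where v: "v \<in> verts (ZA n)" "fst e = unroll i0 c v" by blast
  obtain a k where ak: "v = (a, k)" "1 \<le> k" "k \<le> n" using v(1) by (auto simp: ZA_def)
  define d where "d = c + int m * (int k - 1)"
  have d: "2 \<le> d" "d \<le> int N - 2" using row_range[OF c, of "int k"] ak by (auto simp: d_def)
  have fe: "fst e = chord N (i0 + int m * a) d" by (simp add: v ak unroll_def d_def)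
  have "(fst e, snd e) \<in> steps N (int m)" using e by simp
  from steps_from[OF this[unfolded fe] _ d] consider
    "snd e = chord N (i0 + int m * a) (d + int m)" "d + int m \<le> int N - 2"
    | "snd e = chord N (i0 + int m * a + int m) (d - int m)" "2 \<le> d - int m"
    by auto
  then have "\<exists>w. (v, w) \<in> arcs (ZA n) \<and> snd e = unroll i0 c w"
  proof cases
    case 1
    have "d + int m = c + int m * int k" by (simp add: d_def algebra_simps)
    then have "k + 1 \<le> n" using row_range_conv(2)[OF c, of "int k"] 1 d by auto
    then have "(v, (a, k + 1)) \<in> arcs (ZA n)" using ak by (auto simp: ZA_def)
    moreover have "snd e = unroll i0 c (a, k + 1)"
      using 1 \<open>d + int m = c + int m * int k\<close> by (simp add: unroll_def)
    ultimately show ?thesis by blast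
  next
    case 2
    have dm: "d - int m = c + int m * (int k - 2)" by (simp add: d_def algebra_simps)
    then have "0 \<le> int k - 2" using row_range_conv(1)[OF c, of "int k - 2"] 2 d by auto
    then obtain l where l: "k = l + 1" "1 \<le> l" by (intro that[of "k - 1"]) auto
    then have "(v, (a + 1, l)) \<in> arcs (ZA n)" using ak by (auto simp: ZA_def)
    moreover have "snd e = unroll i0 c (a + 1, l)"
      using 2 dm l by (simp add: unroll_def algebra_simps)
    ultimately show ?thesis by blast
  qed
  then obtain w where "(v, w) \<in> arcs (ZA n)" "e = (unroll i0 c v, unroll i0 c w)"
    using v(2) by (metis prod.collapse)
  then show "e \<in> map_prod (unroll i0 c) (unroll i0 c) ` arcs (ZA n)"
    by (metis image_eqI map_prod_simp)
qed

text \<open>Reduces the identification of a component to matching the fibres of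
  \<open>unroll\<close> with the orbits of \<open>f\<close>; everything else asked of a covering
  holds for all admissible \<open>c\<close>.\<close>

lemma part_isomorphic_quotient:
  assumes c: "2 \<le> c" "c \<le> int h + 1"
    and iso: "tq_iso f (map_prod f f) (ZA n) (ZA n)"
    and ker: "\<And>a k a' k'. 1 \<le> k \<Longrightarrow> k \<le> n \<Longrightarrow> 1 \<le> k' \<Longrightarrow> k' \<le> n \<Longrightarrow>
      unroll i0 c (a, k) = unroll i0 c (a', k') \<longleftrightarrow>
      (\<exists>s. (f ^^ s) (a, k) = (a', k') \<or> (f ^^ s) (a', k') = (a, k))"
  shows "tq_isomorphic (part (i0, c)) (ZA_quotient n f)"
  unfolding ZA_quotient_def
proof (rule tq_isomorphic_quotient[OF iso tq_wf_ZA])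
  have part: "part (i0, c) = tq_full_sub Q (V i0 c)" by (simp add: part_def)
  have sub: "arcs (tq_full_sub Q (V i0 c)) \<subseteq> arcs Q" by (auto simp: tq_full_sub_def)
  show "inj_on (tq_ends (part (i0, c))) (arcs (part (i0, c)))"
    unfolding part ends_full_sub using inj_ends_Q sub by (rule inj_on_subset)
  have "verts Q \<inter> V i0 c = V i0 c" using V_subset verts_Q by blast
  then show "tq_ends (part (i0, c)) ` arcs (part (i0, c)) =
      (map_prod (unroll i0 c) (unroll i0 c) \<circ> tq_ends (ZA n)) ` arcs (ZA n)"
    unfolding part ends_full_sub image_comp[symmetric] ends_arcs_full_sub ends_Q ends_ZA
    by (simp add: unroll_image_arcs[OF c])
  show "unroll i0 c ` verts (ZA n) = verts (part (i0, c))"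
    unfolding part verts_full_sub_V unroll_image[OF c] ..
  show "unroll i0 c (transl (ZA n) v) = transl (part (i0, c)) (unroll i0 c v)" for v
    unfolding part transl_full_sub by (cases v) (simp add: ZA_def unroll_def transl_Q algebra_simps)
  show "unroll i0 c v = unroll i0 c w \<longleftrightarrow> (\<exists>s. (f ^^ s) v = w \<or> (f ^^ s) w = v)"
    if "v \<in> verts (ZA n)" "w \<in> verts (ZA n)" for v w
    using that ker by (cases v, cases w) (simp add: ZA_def)
  fix e e' assume e: "e \<in> arcs (ZA n)" "e' \<in> arcs (ZA n)" "tail (ZA n) e = tail (ZA n) e'"
    and eq: "unroll i0 c (head (ZA n) e) = unroll i0 c (head (ZA n) e')"
  \<comment> \<open>These are the targets of the two arrows leaving \<open>(a, k)\<close>. They lie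
    in different rows, so only a flip could identify them; then \<open>N\<close> would divide the
    length of the common tail, which lies between 2 and \<open>N - 2\<close>.\<close>
  have ne: "unroll i0 c (a, k + 1) \<noteq> unroll i0 c (a + 1, k - 1)"
    if k: "2 \<le> k" "k + 1 \<le> n" for a and k :: nat
  proof
    have k1: "1 \<le> k - 1" "k - 1 \<le> n" "k + 1 \<noteq> k - 1" using k by auto
    assume "unroll i0 c (a, k + 1) = unroll i0 c (a + 1, k - 1)"
    then have "int N dvd int m * (a - (a + 1)) - (c + int m * (int (k - 1) - 1))"
      using unroll_eq_iff[OF c le_add2 k(2) k1(1,2), of i0 a "a + 1"] k1(3) by blast
    moreover have "int m * (a - (a + 1)) - (c + int m * (int (k - 1) - 1)) = - (c + int m * (int k - 1))"
      using k by (simp add: of_nat_diff algebra_simps)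
    ultimately have "int N dvd c + int m * (int k - 1)" by (metis dvd_minus_iff)
    then show False
      using row_range[OF c, of "int k"] k dvd_small_eq_0[of "int N" "c + int m * (int k - 1)"] by auto
  qed
  obtain a k where ak: "fst e = (a, k)" by (cases "fst e")
  have e1: "snd e = (a, k + 1) \<and> k + 1 \<le> n \<or> snd e = (a + 1, k - 1) \<and> 2 \<le> k"
    using e(1) ak by (auto simp: ZA_def)
  have e2: "snd e' = (a, k + 1) \<and> k + 1 \<le> n \<or> snd e' = (a + 1, k - 1) \<and> 2 \<le> k"
    using e(2,3) ak by (auto simp: ZA_def)
  have "unroll i0 c (snd e) = unroll i0 c (snd e')" using eq by (simp add: ZA_def)
  then have "snd e = snd e'" using e1 e2 ne[of k a] by metis
  moreover have "fst e = fst e'" using e(3) by (simp add: ZA_def)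
  ultimately show "e = e'" by (rule prod_eqI[rotated])
qed

text \<open>Cancel 2 from \<open>N = 2 * L\<close> and \<open>m = 2 * h\<close>; then
  \<open>h\<close> is coprime to \<open>L = n * h + 1\<close>.\<close>

lemma N_dvd_iff: "int N dvd int m * x \<longleftrightarrow> L dvd x"
proof -
  have "coprime L (int h)"
  proof (rule coprimeI)
    fix b assume "b dvd L" "b dvd int h"
    then have "b dvd L - int n * int h" by (intro dvd_diff) auto
    then show "is_unit b" by (simp add: L_def)
  qed
  moreover have "int N dvd int m * x \<longleftrightarrow> 2 * L dvd 2 * (int h * x)"
    by (simp add: N_L int_m mult.assoc)
  ultimately show ?thesis by (simp add: coprime_dvd_mult_right_iff)
qed

text \<open>No flip identifies points of the strip here: it would make \<open>h\<close> divide
  \<open>c - 1\<close> and hence \<open>c = h + 1\<close>. Then \<open>h\<close> is even and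
  \<open>c\<close> odd, so the even number \<open>N\<close> would divide an odd one. Only the shift
  by \<open>L\<close> remains.\<close>

lemma part_isomorphic_cylinder:
  assumes c: "2 \<le> c" "c \<le> int h + 1" and not_self_dual: "c = int h + 1 \<Longrightarrow> even h"
  shows "tq_isomorphic (part (i0, c)) (ZA_quotient n (ZA_shift L))"
proof (rule part_isomorphic_quotient[OF c tq_iso_ZA_shift])
  fix a a' :: int and k k' :: nat
  assume k: "1 \<le> k" "k \<le> n" "1 \<le> k'" "k' \<le> n"
  have False if 1: "int N dvd int m * (a - a') - (c + int m * (int k' - 1))"
    and 2: "2 * c + int m * (int k + int k' - 2) = int N"
  proof -
    have "2 * (c - 1) = int m * (int n - (int k + int k' - 2))" using 2 by (simp add: int_N algebra_simps)
    then have "int m dvd 2 * (c - 1)" by simp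
    then have "int h dvd c - 1" by (metis dvd_times_left_cancel_iff int_m zero_neq_numeral)
    then have "int h dvd (c - 1) - int h" by simp
    moreover have "\<bar>(c - 1) - int h\<bar> < int h" using c by auto
    ultimately have "c - 1 - int h = 0" by (rule dvd_small_eq_0)
    then have c': "c = int h + 1" by simp
    then have "odd c" using not_self_dual by auto
    moreover have "even (int m * (a - a') - (c + int m * (int k' - 1)))"
      by (rule dvd_trans[OF _ 1]) (simp add: N_L)
    ultimately show False by (simp add: int_m)
  qed
  then show "unroll i0 c (a, k) = unroll i0 c (a', k') \<longleftrightarrow>
      (\<exists>s. (ZA_shift L ^^ s) (a, k) = (a', k') \<or> (ZA_shift L ^^ s) (a', k') = (a, k))"
    unfolding unroll_eq_iff[OF c k] ZA_shift_orbit N_dvd_iff by blast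
qed

text \<open>In the self-dual class the flip is a symmetry of the sheet. For
  \<open>h = 2 * g + 1\<close> the length in row \<open>k'\<close> equals
  \<open>m * (k' + n * g) - N * g\<close>, so modulo \<open>N\<close> the flip moves by
  \<open>k' + n * g\<close> columns and reflects the rows. Its square is the shift by
  \<open>2 * n * g + n + 1 = L\<close>.\<close>

lemma part_isomorphic_moebius_band:
  assumes g: "h = 2 * g + 1"
  shows "tq_isomorphic (part (i0, int h + 1)) (ZA_quotient n (ZA_glide n (int n * int g)))"
proof (rule part_isomorphic_quotient[OF _ _ tq_iso_ZA_glide])
  show c: "2 \<le> int h + 1" "int h + 1 \<le> int h + 1" using h by auto
  fix a a' :: int and k k' :: nat
  assume k: "1 \<le> k" "k \<le> n" "1 \<le> k'" "k' \<le> n"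
  let ?q = "int n * int g"
  have hg: "int h = 2 * int g + 1" using g by simp
  have L': "2 * ?q + int n + 1 = L" by (simp add: L_def hg algebra_simps)
  have "int N dvd int m * (a - a') - ((int h + 1) + int m * (int k' - 1)) \<longleftrightarrow>
      L dvd a - a' - int k' - ?q"
  proof -
    have "int m * (a - a' - int k' - ?q) =
        int m * (a - a') - ((int h + 1) + int m * (int k' - 1)) - int N * int g"
      by (simp add: int_m int_N hg algebra_simps)
    then show ?thesis using N_dvd_iff[of "a - a' - int k' - ?q"]
      by (metis dvd_add dvd_diff diff_add_cancel dvd_triv_left)
  qed
  moreover have "2 * (int h + 1) + int m * (int k + int k' - 2) = int N \<longleftrightarrow> k + k' = n + 1"
  proof -
    have "2 * (int h + 1) + int m * (int k + int k' - 2) - int N = int m * (int k + int k' - (int n + 1))"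
      by (simp add: int_m int_N algebra_simps)
    then have "2 * (int h + 1) + int m * (int k + int k' - 2) = int N \<longleftrightarrow>
        int m * (int k + int k' - (int n + 1)) = 0"
      by (subst eq_iff_diff_eq_0) (simp only:)
    also have "\<dots> \<longleftrightarrow> int k + int k' = int n + 1" using m_pos by simp
    also have "\<dots> \<longleftrightarrow> k + k' = n + 1" by linarith
    finally show ?thesis .
  qed
  ultimately show "unroll i0 (int h + 1) (a, k) = unroll i0 (int h + 1) (a', k') \<longleftrightarrow>
      (\<exists>s. (ZA_glide n ?q ^^ s) (a, k) = (a', k') \<or> (ZA_glide n ?q ^^ s) (a', k') = (a, k))"
    using k by (subst ZA_glide_orbit) (auto simp: unroll_eq_iff[OF c k] N_dvd_iff L')
qed


section \<open>The class of length 1 modulo \<open>m\<close> is the quiver of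
  \<open>m\<close>-diagonals\<close>

lemma m_diagonals_eq: "m_diagonals n m = V 1 1"
proof (intro equalityI subsetI)
  fix x assume "x \<in> m_diagonals n m"
  then obtain i j r where x: "x \<in> diagonals N" "x = dgl N i j"
    and r: "gon_size N i j = int m * r + 2"
    unfolding m_diagonals_def N[symmetric] by blast
  have "(j - i) mod int N = int m * r + 1" using r by (simp add: gon_size_def)
  then have eq: "x = chord N i (int m * r + 1)" using x(2) by (simp add: dgl_eq_chord)
  have "(int m * r + 1) mod int N = int m * r + 1"
    using \<open>(j - i) mod int N = int m * r + 1\<close> by (metis mod_mod_trivial)
  then have "2 \<le> int m * r + 1" "int m * r + 1 \<le> int N - 2"
    using x(1) N_ge unfolding eq by (simp_all add: chord_mem_diagonals)
  then show "x \<in> V 1 1" unfolding eq by (intro odd_self_dual_V) auto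
next
  fix x assume "x \<in> V 1 1"
  then obtain a r where x: "x = chord N (1 + int m * a) (1 + int m * r)"
    and r: "2 \<le> 1 + int m * r" "1 + int m * r \<le> int N - 2"
    by (rule V_E)
  let ?i = "1 + int m * a" and ?j = "1 + int m * a + (1 + int m * r)"
  have x': "x = dgl N ?i ?j" "x = dgl N ?j ?i"
    by (simp_all add: x chord_def dgl_def insert_commute)
  have xd: "x \<in> diagonals N" using \<open>x \<in> V 1 1\<close> V_subset by blast
  have "1 \<le> r"
  proof (rule ccontr)
    assume "\<not> 1 \<le> r"
    then have "int m * r \<le> int m * 0" by (intro mult_left_mono) auto
    then show False using r by simp
  qed
  have "r \<le> int n - 1"
  proof (rule ccontr)
    assume "\<not> r \<le> int n - 1"
    then have "int m * int n \<le> int m * r" by (intro mult_left_mono) auto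
    moreover have "int N - 2 = int m * int n" by (simp add: int_N)
    ultimately show False using r by linarith
  qed
  have s1: "gon_size N ?i ?j = int m * r + 2"
    using r by (simp add: gon_size_def)
  have "(?i - ?j) mod int N = int N - (1 + int m * r)"
    using r zmod_zminus1_eq_if[of "1 + int m * r" "int N"] by (simp add: algebra_simps)
  then have s2: "gon_size N ?j ?i = int m * (int n - r) + 2"
    by (simp add: gon_size_def int_N algebra_simps)
  show "x \<in> m_diagonals n m"
  \<comment> \<open>The definition of \<open>m_diagonals\<close> measures the side with the smaller
    \<open>r\<close>; in the other case the end points are exchanged, which replaces
    \<open>r\<close> by \<open>n - r\<close>.\<close>
  proof (cases "r \<le> int n div 2")
    case True
    then show ?thesis unfolding m_diagonals_def N[symmetric] ceiling_half_pred
      using xd x'(1) s1 s2 \<open>1 \<le> r\<close> by blast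
  next
    case False
    then have "1 \<le> int n - r" "int n - r \<le> int n div 2" using \<open>r \<le> int n - 1\<close> by linarith+
    moreover have "gon_size N ?i ?j = int m * (int n - (int n - r)) + 2" using s1 by simp
    ultimately show ?thesis unfolding m_diagonals_def N[symmetric] ceiling_half_pred
      using xd x'(2) s2 by blast
  qed
qed

lemma arcs_Gamma_mA: "arcs (Gamma_mA n m) = steps N (int m) \<inter> V 1 1 \<times> V 1 1"
proof (intro equalityI subsetI)
  fix e assume "e \<in> arcs (Gamma_mA n m)"
  then obtain y i j where e: "e = (dgl N i j, y)" "dgl N i j \<in> V 1 1" "y \<in> V 1 1"
    "y = dgl N i (j + int m) \<or> y = dgl N (i + int m) j"
    unfolding Gamma_mA_def N[symmetric] m_diagonals_eq by auto
  have "dgl N i j \<in> diagonals N" using e V_subset by blast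
  from dgl_arrow[OF N_ge this e(4)] obtain i' d where
    d: "dgl N i j = chord N i' d" "y = chord N i' (d + int m)" "2 \<le> d" "d \<le> int N - 2" .
  have "int m dvd d - 1"
    using chord_mem_V_imp[of i' d 1 1] e(2) d by auto
  then obtain r where r: "d - 1 = int m * r" by blast
  have "r \<le> int n - 1"
  proof (rule ccontr)
    assume "\<not> r \<le> int n - 1"
    then have "int m * int n \<le> int m * r" by (intro mult_left_mono) auto
    moreover have "int N - 2 = int m * int n" by (simp add: int_N)
    ultimately show False using r d by linarith
  qed
  then have "int m * r \<le> int m * (int n - 1)" by (intro mult_left_mono) auto
  \<comment> \<open>From \<open>r \<le> n - 1\<close> follows
    \<open>d + m \<le> n * m + 1 = N - 1\<close>, so the length does not wrap around; the value
    \<open>N - 1\<close> is then excluded because the target is a diagonal.\<close>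
  then have "d + int m < int N" using r by (simp add: int_N algebra_simps)
  then have "(d + int m) mod int N = d + int m" using d by simp
  moreover have "y \<in> diagonals N" using e V_subset by blast
  ultimately have "d + int m \<le> int N - 2" using d(2) N_ge by (simp add: chord_mem_diagonals)
  then have "e \<in> steps N (int m)" using e(1) d by (simp add: steps_up)
  then show "e \<in> steps N (int m) \<inter> V 1 1 \<times> V 1 1" using e by simp
next
  fix e assume e: "e \<in> steps N (int m) \<inter> V 1 1 \<times> V 1 1"
  then obtain i d where "e = (chord N i d, chord N i (d + int m))" by (auto simp: steps_def)
  moreover have "chord N i d = dgl N i (i + d)" "chord N i (d + int m) = dgl N i ((i + d) + int m)"
    by (simp_all add: chord_def add.assoc)
  ultimately show "e \<in> arcs (Gamma_mA n m)"
    using e unfolding Gamma_mA_def N[symmetric] m_diagonals_eq by auto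
qed

lemma Gamma_mA_same: "tq_same (tq_full_sub Q (V 1 1)) (Gamma_mA n m)"
  unfolding tq_same_def tq_iso_def
proof (intro exI conjI ballI)
  let ?A = "tq_full_sub Q (V 1 1)"
  have "arcs ?A \<subseteq> arcs Q" by (auto simp: tq_full_sub_def)
  then have "inj_on (tq_ends Q) (arcs ?A)" using inj_ends_Q inj_on_subset by blast
  moreover have "verts Q \<inter> V 1 1 = V 1 1" using V_subset verts_Q by blast
  then have "tq_ends Q ` arcs ?A = arcs (Gamma_mA n m)"
    by (simp add: ends_arcs_full_sub arcs_Gamma_mA ends_Q)
  ultimately show "bij_betw (tq_ends Q) (arcs ?A) (arcs (Gamma_mA n m))"
    by (simp add: bij_betw_def)
  show "bij_betw (\<lambda>x. x) (verts ?A) (verts (Gamma_mA n m))"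
    unfolding verts_full_sub_V by (simp add: Gamma_mA_def m_diagonals_eq bij_betw_def)
  show "tail (Gamma_mA n m) (tq_ends Q a) = tail ?A a" "head (Gamma_mA n m) (tq_ends Q a) = head ?A a" for a
    by (simp_all add: Gamma_mA_def tq_ends_def tq_full_sub_def)
  fix x assume "x \<in> verts ?A"
  then obtain i d where "x = chord N i d" unfolding verts_full_sub_V by (auto simp: V_def)
  then show "transl ?A x = transl (Gamma_mA n m) x"
    unfolding Gamma_mA_def N[symmetric] by (simp add: transl_full_sub transl_Q rotate_chord)
qed

section \<open>The components as named in the theorem, and their shapes\<close>

lemma Gamma_comp_eq:
  assumes "2 \<le> c" "c \<le> int h + 1" "j = i + c"
  shows "Gamma_comp n m i j = part (i, c)"
proof -
  have "Gamma_comp n m i j = tq_component Q (chord N i c)"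
    unfolding Gamma_comp_def Gamma_pow_def N[symmetric] Q_def chord_def assms(3) ..
  then show ?thesis
    using component_eq chord_self_mem_V assms(1,2) by (simp add: part_def)
qed

text \<open>The exponent is \<open>n * (h - 1)\<close>, and the square of \<open>ZA_Sigma n\<close>
  contributes \<open>n + 1\<close>; together they give the period
  \<open>L = n * h + 1\<close>.\<close>

lemma part_cylinder:
  assumes "2 \<le> c" "c \<le> int h + 1" "c = int h + 1 \<Longrightarrow> even h"
  shows "tq_isomorphic (part (i, c))
      (ZA_quotient n ((ZA_tau_inv ^^ (n * (m - 2) div 2)) \<circ> (ZA_Sigma n ^^ 2)))"
    and "has_shape n (part (i, c)) (cylinder n)"
proof -
  obtain g where g: "h = Suc g" using h by (cases h) auto
  have e: "n * (m - 2) = 2 * (n * g)" using m g by (simp add: algebra_simps)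
  have "int h = int g + 1" using g by simp
  then have "int (n * (m - 2) div 2) + int n + 1 = L" unfolding e by (simp add: L_def algebra_simps)
  then show "tq_isomorphic (part (i, c))
      (ZA_quotient n ((ZA_tau_inv ^^ (n * (m - 2) div 2)) \<circ> (ZA_Sigma n ^^ 2)))"
    using part_isomorphic_cylinder[OF assms] by (simp only: ZA_quotient_tau_Sigma_sq)
  show "has_shape n (part (i, c)) (cylinder n)"
    using L_pos part_isomorphic_cylinder[OF assms] by (rule has_shape_cylinder)
qed

lemma part_moebius_band:
  assumes "odd h"
  shows "tq_isomorphic (part (i, int h + 1))
      (ZA_quotient n ((ZA_tau_inv ^^ (n * (m - 2) div 4)) \<circ> ZA_Sigma n))"
    and "has_shape n (part (i, int h + 1)) (moebius_band n)"
proof -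
  obtain g where g: "h = 2 * g + 1" using assms by (rule oddE)
  \<comment> \<open>For odd \<open>h\<close> the division by 4 in the exponent is exact, with
    quotient the glide parameter \<open>n * g\<close>.\<close>
  have e: "n * (m - 2) = 4 * (n * g)" using m g by (simp add: algebra_simps)
  have "int (n * (m - 2) div 4) = int n * int g" unfolding e by simp
  then show "tq_isomorphic (part (i, int h + 1))
      (ZA_quotient n ((ZA_tau_inv ^^ (n * (m - 2) div 4)) \<circ> ZA_Sigma n))"
    using part_isomorphic_moebius_band[OF g] by (simp only: ZA_tau_Sigma)
  show "has_shape n (part (i, int h + 1)) (moebius_band n)"
    using part_isomorphic_moebius_band[OF g] by (rule has_shape_moebius_band[rotated]) simp
qed

text \<open>The diagonals \<open>(1, i + 2)\<close> and \<open>(2, i + 3)\<close> both have length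
  \<open>i + 1\<close>, so the index \<open>i\<close> of the union stands for the class
  \<open>c = i + 1\<close>.\<close>

lemma others_eq:
  "(\<Union>i \<in> {1..int m div 2 - 1}. {Gamma_comp n m 1 (i + 2), Gamma_comp n m 2 (i + 3)}) \<union>
      (if even (m div 2) then {Gamma_comp n m 1 (int m div 2 + 2)}
       else (\<Union>k \<in> {1..2}. {Gamma_comp n m k (int m div 2 + 1 + k)})) = part ` J"
proof -
  have m2: "int m div 2 = int h" "m div 2 = h" using m by simp_all
  have "(\<Union>i \<in> {1..int h - 1}. {Gamma_comp n m 1 (i + 2), Gamma_comp n m 2 (i + 3)}) =
      (\<Union>i \<in> {1..int h - 1}. {part (1, i + 1), part (2, i + 1)})"
  proof (intro SUP_cong refl)
    fix i assume "i \<in> {1..int h - 1}"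
    then have "Gamma_comp n m 1 (i + 2) = part (1, i + 1)" "Gamma_comp n m 2 (i + 3) = part (2, i + 1)"
      by (intro Gamma_comp_eq; simp)+
    then show "{Gamma_comp n m 1 (i + 2), Gamma_comp n m 2 (i + 3)} = {part (1, i + 1), part (2, i + 1)}"
      by simp
  qed
  also have "\<dots> = (\<Union>c \<in> {2..int h}. {part (1, c), part (2, c)})"
  proof -
    have "{2..int h} = (\<lambda>i. i + 1) ` {1..int h - 1}" by simp
    then show ?thesis by (simp only: image_image)
  qed
  also have "\<dots> = part ` ({1, 2} \<times> {2..int h})" by auto
  finally have 1: "(\<Union>i \<in> {1..int h - 1}. {Gamma_comp n m 1 (i + 2), Gamma_comp n m 2 (i + 3)}) =
      part ` ({1, 2} \<times> {2..int h})" .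
  have "{1..2::int} = {1, 2}" by auto
  moreover have "Gamma_comp n m 1 (int h + 2) = part (1, int h + 1)"
    "Gamma_comp n m 1 (int h + 1 + 1) = part (1, int h + 1)"
    "Gamma_comp n m 2 (int h + 1 + 2) = part (2, int h + 1)"
    using h by (intro Gamma_comp_eq; simp)+
  ultimately have 2: "(if even h then {Gamma_comp n m 1 (int h + 2)}
       else (\<Union>k \<in> {1..2}. {Gamma_comp n m k (int h + 1 + k)})) =
      part ` (if even h then {(1, int h + 1)} else {(1, int h + 1), (2, int h + 1)})"
    by (simp only:) auto
  show ?thesis unfolding m2 1 2 J_def image_Un ..
qed

lemma exceptions_eq:
  "(if even (m div 2) then {}
       else {Gamma_comp n m 1 (int m div 2 + 2), Gamma_comp n m 2 (int m div 2 + 3)}) =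
    (if even h then {} else {part (1, int h + 1), part (2, int h + 1)})"
proof -
  have m2: "int m div 2 = int h" "m div 2 = h" using m by simp_all
  have "Gamma_comp n m 1 (int h + 2) = part (1, int h + 1)"
    "Gamma_comp n m 2 (int h + 3) = part (2, int h + 1)"
    using h by (intro Gamma_comp_eq; simp)+
  then show ?thesis unfolding m2 by simp
qed

end

text \<open>For \<open>n = 1\<close> there are no \<open>m\<close>-diagonals and
  \<open>Gamma_mA_in_pow n m\<close> is the empty quiver. It is then no component, though it may
  stand in the union, and the count of components is stated for \<open>2 \<le> n\<close>.\<close>

theorem theorem4p16:
  fixes n m :: nat
  assumes "1 \<le> n" and "1 \<le> m" and "even m"
  defines "others \<equiv>
      (\<Union>i \<in> {1..int m div 2 - 1}. {Gamma_comp n m 1 (i + 2), Gamma_comp n m 2 (i + 3)}) \<union>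
      (if even (m div 2) then {Gamma_comp n m 1 (int m div 2 + 2)}
       else (\<Union>k \<in> {1..2}. {Gamma_comp n m k (int m div 2 + 1 + k)}))"
    and "exceptions \<equiv>
      (if even (m div 2) then {}
       else {Gamma_comp n m 1 (int m div 2 + 2), Gamma_comp n m 2 (int m div 2 + 3)})"
  shows
    "tq_same (Gamma_mA_in_pow n m) (Gamma_mA n m) \<and>
     tq_components (Gamma_pow n m) =
       (if n = 1 then others else {Gamma_mA_in_pow n m} \<union> others) \<and>
     tq_is_union (Gamma_pow n m) ({Gamma_mA_in_pow n m} \<union> others) \<and>
     (2 \<le> n \<longrightarrow>
       card (tq_components (Gamma_pow n m)) = (if even (m div 2) then m else m + 1)) \<and>
     (\<forall>C \<in> tq_components (Gamma_pow n m) - {Gamma_mA_in_pow n m} - exceptions.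
        tq_isomorphic C
          (ZA_quotient n ((ZA_tau_inv ^^ (n * (m - 2) div 2)) \<circ> (ZA_Sigma n ^^ 2))) \<and>
        has_shape n C (cylinder n)) \<and>
     (\<forall>C \<in> exceptions.
        tq_isomorphic C
          (ZA_quotient n ((ZA_tau_inv ^^ (n * (m - 2) div 4)) \<circ> ZA_Sigma n)) \<and>
        has_shape n C (moebius_band n))"
proof -
  obtain h where h: "m = 2 * h" using assms(3) by (rule evenE)
  then have half: "m div 2 = h" by simp
  define N where "N = n * m + 2"
  interpret even_power n m h N
  proof
    show "1 \<le> h" using assms(2) h by simp
  qed (fact assms(1) h N_def)+
  have pow: "Gamma_pow n m = Q" unfolding Gamma_pow_def Q_def by (simp only: N_def)
  have mA: "Gamma_mA_in_pow n m = tq_full_sub Q (V 1 1)"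
    unfolding Gamma_mA_in_pow_def pow m_diagonals_eq ..
  have others: "others = part ` J" unfolding others_def by (rule others_eq)
  have exceptions: "exceptions = (if even h then {} else {part (1, int h + 1), part (2, int h + 1)})"
    unfolding exceptions_def by (rule exceptions_eq)
  have cyl: "tq_isomorphic C
        (ZA_quotient n ((ZA_tau_inv ^^ (n * (m - 2) div 2)) \<circ> (ZA_Sigma n ^^ 2))) \<and>
      has_shape n C (cylinder n)"
    if C: "C \<in> tq_components Q - {tq_full_sub Q (V 1 1)} - exceptions" for C
  proof -
    obtain i c where ic: "(i, c) \<in> J" "C = part (i, c)"
      using C unfolding components_Q by (auto split: if_splits)
    \<comment> \<open>For odd \<open>h\<close> both components of class \<open>h + 1\<close> are
      among the exceptions, from which \<open>C\<close> was removed.\<close>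
    have "even h" if "c = int h + 1"
      using C ic(2) J_cases(1)[OF ic(1)] that unfolding exceptions by (auto split: if_splits)
    then show ?thesis unfolding ic(2) using J_cases(2,3)[OF ic(1)] part_cylinder by blast
  qed
  have moeb: "tq_isomorphic C
        (ZA_quotient n ((ZA_tau_inv ^^ (n * (m - 2) div 4)) \<circ> ZA_Sigma n)) \<and>
      has_shape n C (moebius_band n)" if C: "C \<in> exceptions" for C
  proof -
    obtain i where "C = part (i, int h + 1)" "odd h"
      using C unfolding exceptions by (auto split: if_splits)
    then show ?thesis using part_moebius_band by blast
  qed
  have comps: "tq_components Q = (if n = 1 then others else {tq_full_sub Q (V 1 1)} \<union> others)"
    unfolding others components_Q by simp
  have union: "tq_is_union Q ({tq_full_sub Q (V 1 1)} \<union> others)"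
    using union_Q unfolding others by simp
  show ?thesis
    unfolding pow mA half
    by (intro conjI ballI impI Gamma_mA_same comps union card_components_Q)
      (use cyl moeb in blast)+
qed



end
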